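(* Let $(\xi,\mu,\eta)$ be a linear representation over $\Sigma=\{a_1,\dots,a_\ell,b\}$ satisfying the standing assumptions in the context, assume that the matrix $M=A_1+\cdots+A_\ell+B$ is primitive, let $\lambda$ be its Perron-Frobenius eigenvalue, and let $\mathbf{Y}_n$ be the associated $\mathbb{R}^\ell$-valued symbol statistics. With the functions $y(\mathbf{t})$ and $r(\mathbf{t})$ defined in the context, there is $\varepsilon\in(0,1)$ such that, as $n\to\infty$, the covariance matrix of $\mathbf{Y}_n$ satisfies $$\mathrm{Cov}(\mathbf{Y}_n)=n\,\Gamma+C+O(\varepsilon^n),$$ where $\Gamma=[\gamma_{ij}]$ and $C=[c_{ij}]$ are the $\ell\times\ell$ matrices given by $$\gamma_{ij}=\frac{\partial^2\log y}{\partial t_i\partial t_j}(\mathbf{0})=\frac{1}{\lambda}\frac{\partial^2y}{\partial t_i\partial t_j}(\mathbf{0})-\frac{1}{\lambda^2}\frac{\partial y}{\partial t_i}(\mathbf{0})\frac{\partial y}{\partial t_j}(\mathbf{0}),\qquad c_{ij}=\frac{\partial^2r}{\partial t_i\partial t_j}(\mathbf{0})-\frac{\partial r}{\partial t_i}(\mathbf{0})\frac{\partial r}{\partial t_j}(\mathbf{0}).$$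
   Context: Model. Let $\ell\ge 1$, $m\ge 1$ be integers, $\Sigma=\{a_1,\dots,a_\ell,b\}$ a finite alphabet with $\ell+1$ symbols, $\mathbb{R}_+=[0,\infty)$. Fix column vectors $\xi,\eta\in\mathbb{R}_+^m$ and matrices $A_1,\dots,A_\ell,B\in\mathbb{R}_+^{m\times m}$. Let $\mu$ be the monoid morphism from the set $\Sigma^*$ of all words over $\Sigma$ to $\mathbb{R}_+^{m\times m}$ with $\mu(a_i)=A_i$, $\mu(b)=B$. The triple $(\xi,\mu,\eta)$ is called a linear representation. A prime on a vector or matrix denotes transposition. Put $M=A_1+\cdots+A_\ell+B$. Standing assumptions: all of $A_1,\dots,A_\ell,B$ are nonzero matrices, and for every sufficiently large $n$ there is a word $w$ of length $n$ with $\xi'\mu(w)\eta>0$ (so $\xi\ne 0\ne\eta$ and $\xi'M^n\eta>0$ for all large $n$). For such $n$, the set $\Sigma^n$ of words of length $n$ carries the probability measure $\Pr(w)=\dfrac{\xi'\mu(w)\eta}{\xi'M^n\eta}$, and $\mathbf{Y}_n=(Y_{n,1},\dots,Y_{n,\ell})=(|w|_{a_1},\dots,|w|_{a_\ell})$, where $w$ is random in $\Sigma^n$ with law $\Pr$ and $|w|_{x}$ is the number of occurrences of $x$ in $w$. $\mathrm{Cov}(\mathbf{Y}_n)=[\mathrm{Cov}(Y_{n,i},Y_{n,j})]_{i,j}$; the $O(\varepsilon^n)$ is entrywise. A matrix $T\in\mathbb{R}_+^{m\times m}$ is primitive if $T^k$ has all entries strictly positive for some $k\ge 1$; its Perron-Frobenius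 eigenvalue is its unique eigenvalue of largest modulus, which is real, positive and simple and admits strictly positive left and right eigenvectors. If $M$ is primitive then $M(\mathbf{t})=A_1e^{t_1}+\cdots+A_\ell e^{t_\ell}+B$ is primitive for all $\mathbf{t}\in\mathbb{R}^\ell$; $y(\mathbf{t})$ denotes its Perron-Frobenius eigenvalue (so $y(\mathbf{0})=\lambda$), and $v_{\mathbf{t}}'$, $u_{\mathbf{t}}$ denote strictly positive left and right eigenvectors of $M(\mathbf{t})$ for $y(\mathbf{t})$ normalized by $v_{\mathbf{t}}'u_{\mathbf{t}}=1$. Put $r(\mathbf{t})=\dfrac{\xi'u_{\mathbf{t}}v_{\mathbf{t}}'\eta}{\xi'u_{\mathbf{0}}v_{\mathbf{0}}'\eta}$. Both $y$ and $r$ are strictly positive and analytic on $\mathbb{R}^\ell$, and $r(\mathbf{0})=1$. *)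

theory Defs
  imports "HOL-Probability.Probability" "HOL-Library.Landau_Symbols"
begin

text \<open>The type \<open>'l\<close> indexes the letters \<open>a_1, ..., a_l\<close> and \<open>'m\<close> indexes the
  states, so that \<open>l = CARD('l)\<close> and \<open>m = CARD('m)\<close>.  The alphabet is \<open>'l option\<close>:
  \<open>Some i\<close> is the letter \<open>a_i\<close> and \<open>None\<close> is the letter \<open>b\<close>.\<close>

definition nonneg_vec :: "real ^ 'm \<Rightarrow> bool" where
  "nonneg_vec x \<longleftrightarrow> (\<forall>i. x $ i \<ge> 0)"

definition nonneg_mat :: "real ^ 'm ^ 'm \<Rightarrow> bool" where
  "nonneg_mat T \<longleftrightarrow> (\<forall>i j. T $ i $ j \<ge> 0)"

text \<open>The operations \<open>*\<close> and \<open>^\<close> on the type \<open>real ^ 'm ^ 'm\<close> are entrywise,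
  hence the separate matrix power.\<close>

primrec mat_pow :: "real ^ 'm ^ 'm \<Rightarrow> nat \<Rightarrow> real ^ 'm ^ 'm" where
  "mat_pow T 0 = mat 1"
| "mat_pow T (Suc k) = T ** mat_pow T k"

definition primitive_mat :: "real ^ 'm ^ 'm \<Rightarrow> bool" where
  "primitive_mat T \<longleftrightarrow> nonneg_mat T \<and> (\<exists>k\<ge>1. \<forall>i j. mat_pow T k $ i $ j > 0)"

definition is_eigenvalue :: "real ^ 'm ^ 'm \<Rightarrow> complex \<Rightarrow> bool" where
  "is_eigenvalue T z \<longleftrightarrow>
     (\<exists>x :: complex ^ 'm. x \<noteq> 0 \<and> map_matrix complex_of_real T *v x = z *s x)"

definition pf_eigenvalue :: "real ^ 'm ^ 'm \<Rightarrow> real" where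
  "pf_eigenvalue T = (THE x. is_eigenvalue T (complex_of_real x) \<and>
     (\<forall>z. is_eigenvalue T z \<and> z \<noteq> complex_of_real x \<longrightarrow> cmod z < \<bar>x\<bar>))"

definition is_pf_eigenvectors :: "real ^ 'm ^ 'm \<Rightarrow> real ^ 'm \<Rightarrow> real ^ 'm \<Rightarrow> bool" where
  "is_pf_eigenvectors T v u \<longleftrightarrow>
     (\<forall>i. v $ i > 0) \<and> (\<forall>i. u $ i > 0) \<and>
     v v* T = pf_eigenvalue T *s v \<and> T *v u = pf_eigenvalue T *s u \<and> v \<bullet> u = 1"

text \<open>For primitive \<open>T\<close> the normalized pair is unique up to replacing \<open>(v, u)\<close> by
  \<open>(v / c, c * u)\<close> with \<open>c > 0\<close>; the matrix \<open>u v'\<close>, and hence the function \<open>r_fun\<close>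
  below, does not depend on the choice.\<close>

definition pf_eigenvectors :: "real ^ 'm ^ 'm \<Rightarrow> (real ^ 'm) \<times> (real ^ 'm)" where
  "pf_eigenvectors T = (SOME p. is_pf_eigenvectors T (fst p) (snd p))"

definition pf_left :: "real ^ 'm ^ 'm \<Rightarrow> real ^ 'm" where
  "pf_left T = fst (pf_eigenvectors T)"

definition pf_right :: "real ^ 'm ^ 'm \<Rightarrow> real ^ 'm" where
  "pf_right T = snd (pf_eigenvectors T)"

fun letter_mat :: "('l \<Rightarrow> real ^ 'm ^ 'm) \<Rightarrow> real ^ 'm ^ 'm \<Rightarrow> 'l option \<Rightarrow> real ^ 'm ^ 'm" where
  "letter_mat A B (Some i) = A i"
| "letter_mat A B None = B"

primrec word_mat ::
    "('l \<Rightarrow> real ^ 'm ^ 'm) \<Rightarrow> real ^ 'm ^ 'm \<Rightarrow> 'l option list \<Rightarrow> real ^ 'm ^ 'm" where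
  "word_mat A B [] = mat 1"
| "word_mat A B (x # w) = letter_mat A B x ** word_mat A B w"

lemma word_mat_append: "word_mat A B (w @ w') = word_mat A B w ** word_mat A B w'"
  by (induction w) (simp_all add: matrix_mul_assoc)

definition total_mat :: "('l::finite \<Rightarrow> real ^ 'm ^ 'm) \<Rightarrow> real ^ 'm ^ 'm \<Rightarrow> real ^ 'm ^ 'm" where
  "total_mat A B = (\<Sum>i\<in>UNIV. A i) + B"

definition tilted_mat ::
    "('l::finite \<Rightarrow> real ^ 'm ^ 'm) \<Rightarrow> real ^ 'm ^ 'm \<Rightarrow> real ^ 'l \<Rightarrow> real ^ 'm ^ 'm" where
  "tilted_mat A B t = (\<Sum>i\<in>UNIV. exp (t $ i) *\<^sub>R A i) + B"

definition y_fun ::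
    "('l::finite \<Rightarrow> real ^ 'm ^ 'm) \<Rightarrow> real ^ 'm ^ 'm \<Rightarrow> real ^ 'l \<Rightarrow> real" where
  "y_fun A B t = pf_eigenvalue (tilted_mat A B t)"

definition r_fun ::
    "real ^ 'm \<Rightarrow> ('l::finite \<Rightarrow> real ^ 'm ^ 'm) \<Rightarrow> real ^ 'm ^ 'm \<Rightarrow> real ^ 'm \<Rightarrow> real ^ 'l \<Rightarrow> real"
  where
  "r_fun \<xi> A B \<eta> t =
     ((\<xi> \<bullet> pf_right (tilted_mat A B t)) * (pf_left (tilted_mat A B t) \<bullet> \<eta>)) /
     ((\<xi> \<bullet> pf_right (tilted_mat A B 0)) * (pf_left (tilted_mat A B 0) \<bullet> \<eta>))"

text \<open>A probability measure whenever \<open>\<xi> \<bullet> (mat_pow (total_mat A B) n *v \<eta>) > 0\<close>, which the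
  standing assumptions guarantee for all large \<open>n\<close>.\<close>

definition word_measure ::
    "real ^ 'm \<Rightarrow> ('l::finite \<Rightarrow> real ^ 'm ^ 'm) \<Rightarrow> real ^ 'm ^ 'm \<Rightarrow> real ^ 'm \<Rightarrow> nat
       \<Rightarrow> 'l option list measure" where
  "word_measure \<xi> A B \<eta> n = point_measure {w. length w = n}
     (\<lambda>w. ennreal ((\<xi> \<bullet> (word_mat A B w *v \<eta>)) / (\<xi> \<bullet> (mat_pow (total_mat A B) n *v \<eta>))))"

definition symbol_counts :: "'l::finite option list \<Rightarrow> real ^ 'l" where
  "symbol_counts w = (\<chi> i. real (count_list w (Some i)))"

definition cov_matrix :: "'w measure \<Rightarrow> ('w \<Rightarrow> real ^ 'l) \<Rightarrow> real ^ 'l ^ 'l" where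
  "cov_matrix P X = (\<chi> i j. \<integral>w. (X w $ i - (\<integral>w'. X w' $ i \<partial>P)) * (X w $ j - (\<integral>w'. X w' $ j \<partial>P)) \<partial>P)"

definition partial_deriv :: "'l::finite \<Rightarrow> (real ^ 'l \<Rightarrow> real) \<Rightarrow> real ^ 'l \<Rightarrow> real" where
  "partial_deriv i f t = deriv (\<lambda>s. f (t + s *\<^sub>R axis i 1)) 0"

definition gamma_mat ::
    "('l::finite \<Rightarrow> real ^ 'm ^ 'm) \<Rightarrow> real ^ 'm ^ 'm \<Rightarrow> real ^ 'l ^ 'l" where
  "gamma_mat A B = (\<chi> i j. partial_deriv i (partial_deriv j (\<lambda>t. ln (y_fun A B t))) 0)"

definition c_mat ::
    "real ^ 'm \<Rightarrow> ('l::finite \<Rightarrow> real ^ 'm ^ 'm) \<Rightarrow> real ^ 'm ^ 'm \<Rightarrow> real ^ 'm \<Rightarrow> real ^ 'l ^ 'l" where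
  "c_mat \<xi> A B \<eta> = (\<chi> i j.
     partial_deriv i (partial_deriv j (r_fun \<xi> A B \<eta>)) 0
     - partial_deriv i (r_fun \<xi> A B \<eta>) 0 * partial_deriv j (r_fun \<xi> A B \<eta>) 0)"

end

theory Submission imports Defs "HOL-Real_Asymp.Real_Asymp" begin

text \<open>Split \<open>M(t) = y(t) P(t) + D(t)\<close> with \<open>P = u v'\<close> the Perron projection, so that
  \<open>M\<^sup>n = y\<^sup>n P + D\<^sup>n\<close> for \<open>n \<ge> 1\<close> and the powers of \<open>D(0)\<close> decay geometrically relative to \<open>\<lambda>\<^sup>n\<close>.
  Resolvent identities show that \<open>y\<close>, \<open>P\<close> and \<open>R = (y - M + P)\<^sup>-\<^sup>1\<close> are continuous, that
  \<open>y\<close> and \<open>P\<close> have partial derivatives which are polynomial in \<open>P\<close>, \<open>R\<close> and \<open>\<partial>M\<close>, and that \<open>R\<close> is again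
  differentiable; hence second derivatives exist.  The moments of \<open>Y\<^sub>n\<close> are the derivatives at 0
  of \<open>\<xi>' M(t)\<^sup>n \<eta> = y\<^sup>n \<xi>' P \<eta> + \<xi>' D\<^sup>n \<eta>\<close>.  The derivatives of \<open>D\<^sup>n\<close> at the single point 0 satisfy linear
  recurrences driven by \<open>D(0)\<close>, so they decay geometrically as well and no estimate uniform in
  \<open>t\<close> is needed.\<close>

section \<open>Perron-Frobenius theory of primitive matrices\<close>

text \<open>Two features of the definitions shape the argument. The eigenvectors are picked by
  \<open>SOME\<close> separately for every matrix, so nothing guarantees that they vary continuously
  with t; the product P = u v' does not depend on the choice, and r(t) is \<xi>'P(t)\<eta> divided
  by its value at 0. Derivatives are iterated one-dimensional ones, so coordinate lines and exact
  increment identities can take the place of analyticity and the implicit function theorem. The form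
  n \<Gamma> + C has an elementary origin: divided by \<lambda>^n \<xi>'P(0)\<eta>, the raw moments
  of order 0, 1 and 2 are polynomials in n up to geometric errors, and in the second moment minus
  the product of first moments the n^2 terms and the terms mixing derivatives of y and r cancel. The
  errors are multiplied by polynomials in n on the way, which motivates the calculus of
  geometrically small and subexponential sequences.\<close>

lemma mat_pow_nonneg: "nonneg_mat T \<Longrightarrow> 0 \<le> mat_pow T k $ i $ j"
  by (induction k arbitrary: i j)
     (auto simp: mat_def matrix_matrix_mult_def nonneg_mat_def intro!: sum_nonneg)

lemma mat_pow_Suc_right: "mat_pow T (Suc k) = mat_pow T k ** T"
proof (induction k)
  case (Suc k)
  have "mat_pow T (Suc (Suc k)) = T ** (mat_pow T k ** T)"
    using Suc by simp
  then show ?case by (simp add: matrix_mul_assoc)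
qed simp

lemma mat_pow_add: "mat_pow T (k + l) = mat_pow T k ** mat_pow T l"
  by (induction k) (simp_all add: matrix_mul_assoc)

lemma transpose_mat_pow: "transpose (mat_pow T k) = mat_pow (transpose T) k"
proof (induction k)
  case (Suc k)
  have "transpose (mat_pow T (Suc k)) = transpose (mat_pow T k) ** transpose T"
    by (simp add: matrix_transpose_mul)
  then show ?case using Suc mat_pow_Suc_right[of "transpose T" k] by simp
qed simp

lemma primitive_transpose: "primitive_mat T \<Longrightarrow> primitive_mat (transpose T)"
  by (auto simp: primitive_mat_def nonneg_mat_def transpose_mat_pow [symmetric]) (auto simp: transpose_def)

lemma mat_pow_eigenvector: "T *v x = c *s x \<Longrightarrow> mat_pow T k *v x = c ^ k *s x"
  by (induction k)
     (simp_all add: matrix_vector_mul_assoc[symmetric] scalar_mult_eq_scaleR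
        matrix_vector_mult_scaleR mult.commute)

lemma mat_pow_left_eigenvector: "x v* T = c *s x \<Longrightarrow> x v* mat_pow T k = c ^ k *s x"
  by (induction k)
     (simp_all add: vector_matrix_mul_assoc[symmetric] scalar_mult_eq_scaleR
        scaleR_vector_matrix_assoc mult.commute)

text \<open>If T x vanished, so would T^k x = T^(k-1) (T x), which is strictly positive. The sum is
  the denominator of the Brouwer map used for \<open>positive_eigenvector_exists\<close>.\<close>

lemma primitive_mult_vec_nonzero:
  fixes T :: "real ^ 'm::finite ^ 'm"
  assumes "primitive_mat T" "\<And>i. 0 \<le> x $ i" "x \<noteq> 0"
  shows "0 < (\<Sum>i\<in>UNIV. (T *v x) $ i)"
proof -
  obtain k where k: "k \<ge> 1" "\<And>i j. mat_pow T k $ i $ j > 0" and nn: "nonneg_mat T"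
    using assms(1) by (auto simp: primitive_mat_def)
  obtain j where j: "x $ j > 0" using assms(2,3) by (metis less_eq_real_def vec_eq_iff zero_index)
  have Tx: "0 \<le> (T *v x) $ i" for i
    using nn assms(2) by (auto simp: matrix_vector_mult_def nonneg_mat_def intro!: sum_nonneg)
  have "T *v x \<noteq> 0"
  proof
    assume T0: "T *v x = 0"
    obtain l where "k = Suc l" using k(1) by (cases k) auto
    then have "mat_pow T k *v x = mat_pow T l *v (T *v x)"
      by (metis mat_pow_Suc_right matrix_vector_mul_assoc)
    then have "(mat_pow T k *v x) $ j = 0" using T0 by simp
    moreover have "(mat_pow T k *v x) $ j > 0"
      unfolding matrix_vector_mult_def vec_lambda_beta
      by (rule sum_pos2[of _ j]) (use k j assms(2) in \<open>auto simp: less_imp_le\<close>)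
    ultimately show False by simp
  qed
  then obtain l where "0 < (T *v x) $ l" using Tx by (force simp: vec_eq_iff less_eq_real_def)
  then show ?thesis using Tx by (intro sum_pos2[of _ l]) auto
qed

text \<open>By Brouwer's theorem, x -> T x / sum (T x) has a fixed point on the standard simplex,
  which is an eigenvector. Only existence is taken from here; dominance of the eigenvalue follows
  later from the contraction estimate.\<close>

lemma positive_eigenvector_exists:
  fixes T :: "real ^ 'm::finite ^ 'm"
  assumes "primitive_mat T"
  obtains u c where "\<And>i. 0 < u $ i" "T *v u = c *s u"
proof -
  define S where "S = {x :: real ^ 'm. (\<forall>i. 0 \<le> x $ i) \<and> (\<Sum>i\<in>UNIV. x $ i) = 1}"
  define f where "f x = (1 / (\<Sum>i\<in>UNIV. (T *v x) $ i)) *\<^sub>R (T *v x)" for x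
  have nn: "nonneg_mat T" using assms by (simp add: primitive_mat_def)
  have Tpos: "0 < (\<Sum>i\<in>UNIV. (T *v x) $ i)" if "x \<in> S" for x
  proof -
    have "x \<noteq> 0" using that by (auto simp: S_def)
    then show ?thesis using primitive_mult_vec_nonzero[OF assms, of x] that by (auto simp: S_def)
  qed
  have "bounded S"
  proof (rule boundedI)
    fix x assume "x \<in> S"
    then show "norm x \<le> 1" using norm_le_l1_cart[of x] by (simp add: S_def)
  qed
  moreover have "closed S"
    unfolding S_def by (intro closed_Collect_conj closed_Collect_all closed_Collect_le closed_Collect_eq continuous_intros)
  ultimately have "compact S" by (simp add: compact_eq_bounded_closed)
  moreover have "convex S"
    by (auto simp: convex_def S_def sum.distrib sum_distrib_left[symmetric])
  \<comment> \<open>Any vertex shows that the simplex is nonempty; \<open>undefined\<close> serves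
    as an arbitrary index.\<close>
  moreover have "axis undefined 1 \<in> S"
    by (auto simp: S_def axis_def)
  then have "S \<noteq> {}" by blast
  moreover have "continuous_on S f"
    unfolding f_def
    by (intro continuous_intros matrix_vector_mult_linear_continuous_on) (use Tpos in force)
  moreover have "f \<in> S \<rightarrow> S"
  proof
    fix x assume x: "x \<in> S"
    have "0 \<le> (T *v x) $ i" for i
      using nn x by (auto simp: S_def matrix_vector_mult_def nonneg_mat_def intro!: sum_nonneg)
    then show "f x \<in> S" using Tpos[OF x]
      by (auto simp: S_def f_def sum_divide_distrib[symmetric])
  qed
  ultimately obtain u where u: "u \<in> S" "f u = u" using brouwer[of S f] by metis
  define c where "c = (\<Sum>i\<in>UNIV. (T *v u) $ i)"
  have c: "c > 0" unfolding c_def using Tpos u by blast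
  have eq: "T *v u = c *s u"
  proof -
    have "c *\<^sub>R u = c *\<^sub>R f u" using u by simp
    also have "\<dots> = T *v u" using c by (simp add: f_def c_def[symmetric])
    finally show ?thesis by (simp add: scalar_mult_eq_scaleR)
  qed
  obtain k where k: "\<And>i j. mat_pow T k $ i $ j > 0" using assms by (auto simp: primitive_mat_def)
  have "u \<noteq> 0" using u(1) by (auto simp: S_def)
  then obtain j where j: "u $ j > 0" using u(1) by (force simp: S_def vec_eq_iff less_eq_real_def)
  \<comment> \<open>Nonnegativity improves to positivity through T^k u = c^k u, whose left side is
    positive in every coordinate.\<close>
  have "0 < u $ i" for i
  proof -
    have "0 < (mat_pow T k *v u) $ i"
      unfolding matrix_vector_mult_def vec_lambda_beta
      by (rule sum_pos2[of _ j]) (use k j u(1) in \<open>auto simp: S_def less_imp_le\<close>)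
    then show ?thesis using c by (simp add: mat_pow_eigenvector[OF eq] zero_less_mult_iff)
  qed
  then show ?thesis using eq that by blast
qed

text \<open>The number \<open>y\<close> is kept abstract instead of being set to
  \<open>pf_eigenvalue T\<close>: any normalized positive eigenpair fits, and
  \<open>pf_eigenvalue_eq\<close> then identifies \<open>y\<close> with the defined
  eigenvalue.\<close>

locale perron =
  fixes T :: "real ^ 'm::finite ^ 'm" and v u :: "real ^ 'm" and y :: real
  assumes primitive: "primitive_mat T"
    and v_pos: "\<And>i. 0 < v $ i" and u_pos: "\<And>i. 0 < u $ i"
    and left_eigen: "v v* T = y *s v" and right_eigen: "T *v u = y *s u"
    and normalized: "v \<bullet> u = 1"
begin

lemma transposed: "perron (transpose T) u v y"
  using primitive_transpose[OF primitive] v_pos u_pos left_eigen right_eigen normalized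
  by unfold_locales (simp_all add: inner_commute)

lemma left_eigen_sum: "(\<Sum>i\<in>UNIV. v $ i * T $ i $ j) = y * v $ j"
  using arg_cong[OF left_eigen, of "\<lambda>x. x $ j"] by (simp add: vector_matrix_mult_def mult_ac)

lemma eigenvalue_pos: "0 < y"
proof -
  obtain k where k: "k \<ge> 1" "\<And>i j. mat_pow T k $ i $ j > 0" and nn: "nonneg_mat T"
    using primitive by (auto simp: primitive_mat_def)
  fix i
  have "0 < (mat_pow T k *v u) $ i"
    unfolding matrix_vector_mult_def vec_lambda_beta
    by (rule sum_pos) (use k u_pos in auto)
  then have "0 < y ^ k * u $ i" by (simp add: mat_pow_eigenvector[OF right_eigen])
  then have "y ^ k \<noteq> 0" by (metis mult_zero_left less_irrefl)
  then have "y \<noteq> 0" using k(1) by auto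
  moreover have "0 \<le> (T *v u) $ i"
    using nn u_pos by (auto simp: matrix_vector_mult_def nonneg_mat_def less_imp_le intro!: sum_nonneg)
  then have "0 \<le> y" using u_pos[of i] by (simp add: right_eigen zero_le_mult_iff)
  ultimately show ?thesis by simp
qed

text \<open>T^k and u v' have finitely many entries, all positive, so a small multiple of u v' lies
  below T^k.\<close>

lemma minorization:
  obtains k d where "k \<ge> 1" "0 < d" "d < y ^ k" "\<And>i j. d * (u $ i * v $ j) \<le> mat_pow T k $ i $ j"
proof -
  obtain k where k: "k \<ge> 1" "\<And>i j. mat_pow T k $ i $ j > 0"
    using primitive by (auto simp: primitive_mat_def)
  define F where "F = (\<lambda>(i, j). mat_pow T k $ i $ j / (u $ i * v $ j)) ` UNIV"
  have F: "finite F" "F \<noteq> {}" "\<And>x. x \<in> F \<Longrightarrow> 0 < x"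
    unfolding F_def using k u_pos v_pos by auto
  \<comment> \<open>The second bound keeps d strictly below y^k, so that the contraction factor q =
    y^k - d is positive and has a positive k-th root.\<close>
  define d where "d = min (Min F) (y ^ k / 2)"
  have yk: "0 < y ^ k" using eigenvalue_pos by simp
  have "0 < d" unfolding d_def using F yk by (simp add: Min_gr_iff)
  moreover have "d < y ^ k" unfolding d_def using yk by simp
  moreover have "d * (u $ i * v $ j) \<le> mat_pow T k $ i $ j" for i j
  proof -
    have "mat_pow T k $ i $ j / (u $ i * v $ j) \<in> F" unfolding F_def by (rule image_eqI[of _ _ "(i, j)"]) auto
    then have "d \<le> mat_pow T k $ i $ j / (u $ i * v $ j)"
      unfolding d_def using F(1) by (simp add: min.coboundedI1)
    then show ?thesis using u_pos[of i] v_pos[of j] by (simp add: pos_le_divide_eq)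
  qed
  ultimately show ?thesis using that k by blast
qed

text \<open>Doeblin's argument: on the kernel of \<open>v'\<close> the matrix \<open>T\<^sup>k\<close> acts as the nonnegative matrix
  \<open>T\<^sup>k - d u v'\<close>, whose norm for the weights \<open>v\<close> is at most \<open>y\<^sup>k - d\<close>.\<close>

lemma contraction:
  "\<exists>k\<ge>1. \<exists>q>0. q < y ^ k \<and> (\<forall>x :: 'm \<Rightarrow> 'b::real_normed_vector. (\<Sum>j\<in>UNIV. v $ j *\<^sub>R x j) = 0 \<longrightarrow>
       (\<Sum>i\<in>UNIV. v $ i * norm (\<Sum>j\<in>UNIV. mat_pow T k $ i $ j *\<^sub>R x j))
         \<le> q * (\<Sum>j\<in>UNIV. v $ j * norm (x j)))"
proof -
  obtain k d where kd: "k \<ge> 1" "0 < d" "d < y ^ k" "\<And>i j. d * (u $ i * v $ j) \<le> mat_pow T k $ i $ j"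
    using minorization by metis
  have left_k: "(\<Sum>i\<in>UNIV. v $ i * mat_pow T k $ i $ j) = y ^ k * v $ j" for j
    using arg_cong[OF mat_pow_left_eigenvector[OF left_eigen, of k], of "\<lambda>x. x $ j"]
    by (simp add: vector_matrix_mult_def mult_ac)
  have vu: "(\<Sum>i\<in>UNIV. v $ i * u $ i) = 1" using normalized by (simp add: inner_vec_def)
  have "(\<Sum>i\<in>UNIV. v $ i * norm (\<Sum>j\<in>UNIV. mat_pow T k $ i $ j *\<^sub>R x j))
         \<le> (y ^ k - d) * (\<Sum>j\<in>UNIV. v $ j * norm (x j))"
    if x: "(\<Sum>j\<in>UNIV. v $ j *\<^sub>R x j) = 0" for x :: "'m \<Rightarrow> 'b"
  proof -
    let ?N = "\<lambda>i j. mat_pow T k $ i $ j - d * (u $ i * v $ j)"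
    have "(\<Sum>j\<in>UNIV. mat_pow T k $ i $ j *\<^sub>R x j) = (\<Sum>j\<in>UNIV. ?N i j *\<^sub>R x j)" for i
    proof -
      have "(\<Sum>j\<in>UNIV. (d * (u $ i * v $ j)) *\<^sub>R x j) = (d * u $ i) *\<^sub>R (\<Sum>j\<in>UNIV. v $ j *\<^sub>R x j)"
        by (simp add: scaleR_sum_right mult_ac)
      then show ?thesis using x by (simp add: scaleR_diff_left sum_subtractf)
    qed
    moreover have "norm (\<Sum>j\<in>UNIV. ?N i j *\<^sub>R x j) \<le> (\<Sum>j\<in>UNIV. ?N i j * norm (x j))" for i
      by (rule sum_norm_le) (use kd(4) in auto)
    ultimately have "(\<Sum>i\<in>UNIV. v $ i * norm (\<Sum>j\<in>UNIV. mat_pow T k $ i $ j *\<^sub>R x j))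
        \<le> (\<Sum>i\<in>UNIV. v $ i * (\<Sum>j\<in>UNIV. ?N i j * norm (x j)))"
      using v_pos by (intro sum_mono mult_left_mono) (auto simp: less_imp_le)
    also have "\<dots> = (\<Sum>j\<in>UNIV. (\<Sum>i\<in>UNIV. v $ i * ?N i j) * norm (x j))"
      unfolding sum_distrib_left sum_distrib_right by (subst sum.swap) (simp add: mult_ac)
    also have "\<dots> = (\<Sum>j\<in>UNIV. ((y ^ k - d) * v $ j) * norm (x j))"
    proof (intro sum.cong arg_cong2[where f = "(*)"] refl)
      fix j
      have "(\<Sum>i\<in>UNIV. v $ i * ?N i j) = y ^ k * v $ j - (\<Sum>i\<in>UNIV. v $ i * u $ i) * (d * v $ j)"
        unfolding left_k[symmetric] sum_distrib_right
        by (simp add: right_diff_distrib sum_subtractf mult_ac)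
      then show "(\<Sum>i\<in>UNIV. v $ i * ?N i j) = (y ^ k - d) * v $ j" by (simp add: vu left_diff_distrib)
    qed
    finally show ?thesis by (simp add: sum_distrib_left mult_ac)
  qed
  with kd show ?thesis by (intro exI[of _ k] conjI exI[of _ "y ^ k - d"] allI impI) simp_all
qed

lemma weighted_norm_pos:
  fixes x :: "'m \<Rightarrow> 'b::real_normed_vector"
  assumes "x i \<noteq> 0"
  shows "0 < (\<Sum>j\<in>UNIV. v $ j * norm (x j))"
  by (rule sum_pos2[of _ i]) (use assms v_pos in \<open>auto simp: less_imp_le\<close>)

text \<open>The left eigenvector annihilates x, since z (v'x) = v'T x = y (v'x) and z differs from
  y. Hence \<open>contraction\<close> applies to x, with complex entries, and gives |z|^k <= q <
  y^k.\<close>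

lemma other_eigenvalues_less:
  assumes "is_eigenvalue T z" "z \<noteq> of_real y"
  shows "cmod z < y"
proof -
  obtain x :: "complex ^ 'm" where x: "x \<noteq> 0" "map_matrix complex_of_real T *v x = z *s x"
    using assms(1) by (auto simp: is_eigenvalue_def)
  have Tx: "(\<Sum>j\<in>UNIV. T $ i $ j *\<^sub>R x $ j) = z * x $ i" for i
    using arg_cong[OF x(2), of "\<lambda>w. w $ i"]
    by (simp add: matrix_vector_mult_def scaleR_conv_of_real)
  have "z * (\<Sum>i\<in>UNIV. v $ i *\<^sub>R x $ i) = (\<Sum>i\<in>UNIV. v $ i *\<^sub>R (\<Sum>j\<in>UNIV. T $ i $ j *\<^sub>R x $ j))"
    unfolding Tx sum_distrib_left by (rule sum.cong) simp_all
  also have "\<dots> = (\<Sum>j\<in>UNIV. (\<Sum>i\<in>UNIV. v $ i * T $ i $ j) *\<^sub>R x $ j)"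
    unfolding scaleR_sum_right scaleR_sum_left by (subst sum.swap) simp
  also have "\<dots> = of_real y * (\<Sum>i\<in>UNIV. v $ i *\<^sub>R x $ i)"
    unfolding left_eigen_sum by (simp add: scaleR_conv_of_real sum_distrib_left mult.assoc)
  finally have vx: "(\<Sum>i\<in>UNIV. v $ i *\<^sub>R x $ i) = 0" using assms(2) by simp
  have pow: "(\<Sum>j\<in>UNIV. mat_pow T k $ i $ j *\<^sub>R x $ j) = z ^ k * x $ i" for k i
  proof (induction k arbitrary: i)
    case 0
    have "(\<Sum>j\<in>UNIV. mat_pow T 0 $ i $ j *\<^sub>R x $ j) = (\<Sum>j\<in>UNIV. if i = j then x $ j else 0)"
      by (rule sum.cong) (auto simp: mat_def)
    then show ?case by simp
  next
    case (Suc k)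
    have "(\<Sum>j\<in>UNIV. mat_pow T (Suc k) $ i $ j *\<^sub>R x $ j)
        = (\<Sum>l\<in>UNIV. T $ i $ l *\<^sub>R (\<Sum>j\<in>UNIV. mat_pow T k $ l $ j *\<^sub>R x $ j))"
      unfolding mat_pow.simps matrix_matrix_mult_def vec_lambda_beta scaleR_sum_right scaleR_sum_left
      by (subst sum.swap) simp
    also have "\<dots> = z ^ k * (\<Sum>l\<in>UNIV. T $ i $ l *\<^sub>R x $ l)"
      unfolding Suc sum_distrib_left by simp
    finally show ?case by (simp add: Tx mult_ac)
  qed
  obtain k q where kq: "k \<ge> 1" "0 < q" "q < y ^ k"
    "\<forall>x :: 'm \<Rightarrow> complex. (\<Sum>j\<in>UNIV. v $ j *\<^sub>R x j) = 0 \<longrightarrow>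
       (\<Sum>i\<in>UNIV. v $ i * norm (\<Sum>j\<in>UNIV. mat_pow T k $ i $ j *\<^sub>R x j))
         \<le> q * (\<Sum>j\<in>UNIV. v $ j * norm (x j))"
    using contraction[where 'b = complex] by blast
  have "cmod z ^ k * (\<Sum>j\<in>UNIV. v $ j * cmod (x $ j)) \<le> q * (\<Sum>j\<in>UNIV. v $ j * cmod (x $ j))"
    using kq(4)[rule_format, of "\<lambda>j. x $ j", OF vx]
    unfolding pow norm_mult norm_power sum_distrib_left by (simp add: mult_ac)
  moreover have "0 < (\<Sum>j\<in>UNIV. v $ j * cmod (x $ j))"
    using x(1) weighted_norm_pos[of "\<lambda>j. x $ j"] by (auto simp: vec_eq_iff)
  ultimately have "cmod z ^ k \<le> q" by (rule mult_right_le_imp_le)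
  then have "cmod z ^ k < y ^ k" using kq(3) by linarith
  then show ?thesis by (rule power_less_imp_less_base) (use eigenvalue_pos in simp)
qed

lemma pf_eigenvalue_eq: "pf_eigenvalue T = y"
  unfolding pf_eigenvalue_def
proof (rule the_equality)
  let ?x = "\<chi> i. complex_of_real (u $ i)"
  have "?x $ i \<noteq> 0" for i using u_pos[of i] by simp
  then have "?x \<noteq> 0" by force
  moreover have "map_matrix complex_of_real T *v ?x = complex_of_real y *s ?x"
  proof -
    have "(\<Sum>j\<in>UNIV. complex_of_real (T $ i $ j) * complex_of_real (u $ j)) = complex_of_real (y * u $ i)" for i
      using arg_cong[OF right_eigen, of "\<lambda>w. complex_of_real (w $ i)"]
      by (simp add: matrix_vector_mult_def)
    then show ?thesis by (simp add: vec_eq_iff matrix_vector_mult_def)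
  qed
  ultimately have ev: "is_eigenvalue T (complex_of_real y)" unfolding is_eigenvalue_def by blast
  then show *: "is_eigenvalue T (complex_of_real y) \<and>
     (\<forall>z. is_eigenvalue T z \<and> z \<noteq> complex_of_real y \<longrightarrow> cmod z < \<bar>y\<bar>)"
    using other_eigenvalues_less eigenvalue_pos by auto
  fix x assume x: "is_eigenvalue T (complex_of_real x) \<and>
     (\<forall>z. is_eigenvalue T z \<and> z \<noteq> complex_of_real x \<longrightarrow> cmod z < \<bar>x\<bar>)"
  \<comment> \<open>Each of two distinct candidates would have strictly smaller modulus than the
    other.\<close>
  show "x = y"
  proof (rule ccontr)
    assume "x \<noteq> y"
    then have "cmod (complex_of_real x) < \<bar>y\<bar>" "cmod (complex_of_real y) < \<bar>x\<bar>"
      using * x by (blast dest: of_real_eq_iff[THEN iffD1])+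
    then show False by simp
  qed
qed

end

text \<open>The left eigenvector comes from the transpose, a priori with another eigenvalue d;
  evaluating w'T u in two ways gives d = c because w'u > 0. Dividing w by w'u gives the
  normalization.\<close>

lemma perron_exists:
  fixes T :: "real ^ 'm::finite ^ 'm"
  assumes "primitive_mat T"
  obtains v u y where "perron T v u y"
proof -
  obtain u c where u: "\<And>i. 0 < u $ i" "T *v u = c *s u"
    using positive_eigenvector_exists[OF assms] by metis
  obtain w d where w: "\<And>i. 0 < w $ i" "transpose T *v w = d *s w"
    using positive_eigenvector_exists[OF primitive_transpose[OF assms]] by metis
  have wT: "w v* T = d *s w" using w(2) by simp
  have pos: "0 < w \<bullet> u" unfolding inner_vec_def using u w by (intro sum_pos) auto
  have "d * (w \<bullet> u) = (w v* T) \<bullet> u" by (simp add: wT scalar_mult_eq_scaleR)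
  also have "\<dots> = c * (w \<bullet> u)" by (simp add: dot_lmul_matrix u scalar_mult_eq_scaleR)
  finally have "d = c" using pos by simp
  then have "(1 / (w \<bullet> u)) *s w v* T = c *s ((1 / (w \<bullet> u)) *s w)"
    using wT by (simp only: scalar_mult_eq_scaleR scaleR_vector_matrix_assoc) simp
  then have "perron T ((1 / (w \<bullet> u)) *s w) u c"
    using u w pos assms
    by unfold_locales (auto simp: scalar_mult_eq_scaleR)
  then show ?thesis using that by blast
qed

text \<open>Bridge to the definitions: the values selected by \<open>THE\<close> and
  \<open>SOME\<close> form a Perron pair, so these operators are not unfolded again.\<close>

lemma perron_pf:
  fixes T :: "real ^ 'm::finite ^ 'm"
  assumes "primitive_mat T"
  shows "perron T (pf_left T) (pf_right T) (pf_eigenvalue T)"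
proof -
  obtain v u y where p: "perron T v u y" using perron_exists[OF assms] by metis
  then have "is_pf_eigenvectors T v u"
    using perron.pf_eigenvalue_eq[OF p] by (simp add: is_pf_eigenvectors_def perron_def)
  then have "is_pf_eigenvectors T (pf_left T) (pf_right T)"
    unfolding pf_left_def pf_right_def pf_eigenvectors_def
    by (rule someI[where P = "\<lambda>p. is_pf_eigenvectors T (fst p) (snd p)" and x = "(v, u)", simplified])
  then show ?thesis using assms by (simp add: is_pf_eigenvectors_def perron_def)
qed

section \<open>Matrix calculus\<close>

lemma bounded_bilinear_matrix_mult:
  "bounded_bilinear ((**) :: real ^ 'n::finite ^ 'm::finite \<Rightarrow> real ^ 'p::finite ^ 'n \<Rightarrow> real ^ 'p ^ 'm)"
  unfolding bilinear_conv_bounded_bilinear[symmetric] bilinear_def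
  by (auto intro!: linearI simp: matrix_matrix_mult_def vec_eq_iff distrib_left distrib_right
      sum.distrib sum_distrib_left mult_ac)

lemma bounded_bilinear_matrix_vector_mult:
  "bounded_bilinear ((*v) :: real ^ 'n::finite ^ 'm::finite \<Rightarrow> real ^ 'n \<Rightarrow> real ^ 'm)"
  unfolding bilinear_conv_bounded_bilinear[symmetric] bilinear_def
  by (auto intro!: linearI simp: matrix_vector_mult_def vec_eq_iff distrib_left distrib_right
      sum.distrib sum_distrib_left mult_ac)

interpretation matrix_mult: bounded_bilinear
  "(**) :: real ^ 'n::finite ^ 'm::finite \<Rightarrow> real ^ 'p::finite ^ 'n \<Rightarrow> real ^ 'p ^ 'm"
  by (rule bounded_bilinear_matrix_mult)

interpretation matrix_vec: bounded_bilinear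
  "(*v) :: real ^ 'n::finite ^ 'm::finite \<Rightarrow> real ^ 'n \<Rightarrow> real ^ 'm"
  by (rule bounded_bilinear_matrix_vector_mult)

lemma bounded_linear_trace: "bounded_linear (trace :: real ^ 'n::finite ^ 'n \<Rightarrow> real)"
  unfolding linear_conv_bounded_linear[symmetric]
  by (rule linearI) (auto simp: trace_def sum.distrib sum_distrib_left)

section \<open>Rank-one matrices\<close>

definition outer :: "real ^ 'm \<Rightarrow> real ^ 'n \<Rightarrow> real ^ 'n ^ 'm" where
  "outer x z = (\<chi> i j. x $ i * z $ j)"

lemma outer_nth [simp]: "outer x z $ i $ j = x $ i * z $ j"
  by (simp add: outer_def)

lemma bounded_bilinear_outer:
  "bounded_bilinear (outer :: real ^ 'm::finite \<Rightarrow> real ^ 'n::finite \<Rightarrow> real ^ 'n ^ 'm)"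
  unfolding bilinear_conv_bounded_bilinear[symmetric] bilinear_def
  by (auto intro!: linearI simp: vec_eq_iff distrib_left distrib_right)

interpretation outer: bounded_bilinear
  "outer :: real ^ 'm::finite \<Rightarrow> real ^ 'n::finite \<Rightarrow> real ^ 'n ^ 'm"
  by (rule bounded_bilinear_outer)

lemma matrix_mult_outer: "X ** outer x z = outer (X *v x) z"
  by (simp add: vec_eq_iff matrix_matrix_mult_def matrix_vector_mult_def sum_distrib_left mult_ac)

lemma outer_matrix_mult: "outer x z ** X = outer x (z v* X)"
  by (simp add: vec_eq_iff matrix_matrix_mult_def vector_matrix_mult_def sum_distrib_left mult_ac)

lemma outer_mult_vec: "outer x z *v w = (z \<bullet> w) *\<^sub>R x"
  by (simp add: vec_eq_iff matrix_vector_mult_def inner_vec_def sum_distrib_left mult_ac)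

lemma vec_mult_outer: "w v* outer x z = (w \<bullet> x) *\<^sub>R z"
  by (simp add: vec_eq_iff vector_matrix_mult_def inner_vec_def sum_distrib_left mult_ac)

lemma trace_outer: "trace (outer x z) = z \<bullet> x"
  by (simp add: trace_def inner_vec_def mult_ac)

section \<open>Continuity and differentiability of matrix inversion\<close>

lemma matrix_inv_left: "invertible X \<Longrightarrow> matrix_inv X ** X = mat 1"
  and matrix_inv_right: "invertible X \<Longrightarrow> X ** matrix_inv X = mat 1"
  unfolding invertible_def matrix_inv_def by (metis (mono_tags, lifting) someI_ex)+

text \<open>Resolvent identity. Being exact, it gives the continuity of the inverse and, after
  division by the increment of the parameter, its derivative.\<close>

lemma matrix_inv_diff:
  fixes X Y :: "real ^ 'n::finite ^ 'n"
  assumes "invertible X" "invertible Y"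
  shows "matrix_inv Y - matrix_inv X = matrix_inv X ** (X - Y) ** matrix_inv Y"
proof -
  have "matrix_inv X ** (X - Y) ** matrix_inv Y
      = matrix_inv X ** X ** matrix_inv Y - matrix_inv X ** (Y ** matrix_inv Y)"
    by (simp add: matrix_mult.diff_left matrix_mult.diff_right matrix_mul_assoc)
  then show ?thesis by (simp add: assms matrix_inv_left matrix_inv_right)
qed

text \<open>Boundedness comes first: by the resolvent identity the distance of the inverse to its
  limit is eventually at most half its own norm, so that norm is at most twice the norm of the
  limit. The same identity then writes the difference as a null function times a bounded
  one.\<close>

lemma tendsto_matrix_inv:
  fixes X :: "'a \<Rightarrow> real ^ 'n::finite ^ 'n"
  assumes X: "(X \<longlongrightarrow> X0) F" and inv: "\<And>s. invertible (X s)" "invertible X0"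
  shows "((\<lambda>s. matrix_inv (X s)) \<longlongrightarrow> matrix_inv X0) F"
proof -
  obtain K where K: "K > 0" "\<And>(a :: real ^ 'n ^ 'n) (b :: real ^ 'n ^ 'n). norm (a ** b) \<le> norm a * norm b * K"
    using matrix_mult.pos_bounded by metis
  let ?R = "matrix_inv X0"
  \<comment> \<open>Chosen so that K^2 |R| e <= 1/2, where K bounds the matrix product; the added 1
    keeps the denominator positive.\<close>
  define e where "e = 1 / (2 * (K * K * (norm ?R + 1)))"
  have e: "e > 0" using K(1) by (simp add: e_def add_nonneg_pos)
  have bounded: "Bfun (\<lambda>s. matrix_inv (X s)) F"
  proof (rule BfunI)
    have "\<forall>\<^sub>F s in F. dist (X s) X0 < e" using X e by (rule tendstoD)
    then show "\<forall>\<^sub>F s in F. norm (matrix_inv (X s)) \<le> 2 * norm ?R"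
    proof eventually_elim
      case (elim s)
      let ?S = "matrix_inv (X s)"
      have "norm (?R ** (X0 - X s) ** ?S) \<le> norm (?R ** (X0 - X s)) * norm ?S * K" by (rule K)
      also have "\<dots> \<le> (norm ?R * norm (X0 - X s) * K) * norm ?S * K"
        using K by (intro mult_right_mono) auto
      also have "\<dots> \<le> (norm ?R * e * K) * norm ?S * K"
        using K elim by (intro mult_right_mono mult_left_mono) (auto simp: dist_norm norm_minus_commute)
      also have "\<dots> = (K * K * norm ?R * e) * norm ?S" by simp
      also have "\<dots> \<le> 1 / 2 * norm ?S"
      proof (rule mult_right_mono)
        have "K * K * norm ?R * e = (norm ?R / (norm ?R + 1)) / 2"
          using K(1) by (simp add: e_def divide_simps)
        also have "\<dots> \<le> 1 / 2" by (simp add: divide_le_eq add_nonneg_pos)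
        finally show "K * K * norm ?R * e \<le> 1 / 2" .
      qed simp
      finally have "norm (?S - ?R) \<le> norm ?S / 2"
        using matrix_inv_diff[OF inv(2) inv(1)[of s]] by simp
      then show ?case using norm_triangle_ineq2[of ?S ?R] by linarith
    qed
  qed
  have "Zfun (\<lambda>s. X0 - X s) F"
    using X tendsto_Zfun_iff Zfun_minus[of "\<lambda>s. X s - X0"] by fastforce
  then have "Zfun (\<lambda>s. ?R ** (X0 - X s) ** matrix_inv (X s)) F"
    by (intro matrix_mult.Zfun_prod_Bfun[OF _ bounded] matrix_mult.Zfun_right)
  then show ?thesis
    unfolding tendsto_Zfun_iff matrix_inv_diff[OF inv(2) inv(1)] .
qed

text \<open>In this form an exact identity for increments can be divided by the increment of the
  parameter and passed to the limit.\<close>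

lemma has_vector_derivative_iff_quotient:
  "(f has_vector_derivative d) (at x) \<longleftrightarrow> ((\<lambda>s. (1 / (s - x)) *\<^sub>R (f s - f x)) \<longlongrightarrow> d) (at x)"
proof -
  have "(f has_vector_derivative d) (at x) \<longleftrightarrow>
      ((\<lambda>s. (1 / norm (s - x)) *\<^sub>R (f s - (f x + (s - x) *\<^sub>R d))) \<longlongrightarrow> 0) (at x)"
    unfolding has_vector_derivative_def has_derivative_within
    by (simp add: bounded_linear_scaleR_left)
  \<comment> \<open>After taking norms, the divisors |s - x| and s - x are interchangeable.\<close>
  also have "\<dots> \<longleftrightarrow> ((\<lambda>s. norm ((1 / norm (s - x)) *\<^sub>R (f s - (f x + (s - x) *\<^sub>R d)))) \<longlongrightarrow> 0) (at x)"
    by (simp only: tendsto_norm_zero_iff)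
  also have "\<dots> \<longleftrightarrow> ((\<lambda>s. norm ((1 / (s - x)) *\<^sub>R (f s - f x) - d)) \<longlongrightarrow> 0) (at x)"
  proof (rule tendsto_cong, rule eventually_at_topological[THEN iffD2], intro exI[of _ UNIV] conjI ballI impI)
    fix s assume "s \<noteq> x"
    then have "(1 / (s - x)) *\<^sub>R (f s - f x) - d = (1 / (s - x)) *\<^sub>R (f s - (f x + (s - x) *\<^sub>R d))"
      by (simp add: scaleR_diff_right scaleR_add_right)
    then show "norm ((1 / norm (s - x)) *\<^sub>R (f s - (f x + (s - x) *\<^sub>R d))) = norm ((1 / (s - x)) *\<^sub>R (f s - f x) - d)"
      by simp
  qed auto
  also have "\<dots> \<longleftrightarrow> ((\<lambda>s. (1 / (s - x)) *\<^sub>R (f s - f x)) \<longlongrightarrow> d) (at x)"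
    by (simp only: tendsto_norm_zero_iff LIM_zero_iff)
  finally show ?thesis .
qed

lemma has_vector_derivative_tendsto:
  "(f has_vector_derivative d) (at x) \<Longrightarrow> (f \<longlongrightarrow> f x) (at x)"
  by (metis has_vector_derivative_continuous continuous_within)

lemma has_vector_derivative_matrix_inv:
  fixes X :: "real \<Rightarrow> real ^ 'n::finite ^ 'n"
  assumes X: "(X has_vector_derivative D) (at s)" and inv: "\<And>s. invertible (X s)"
  shows "((\<lambda>s. matrix_inv (X s)) has_vector_derivative - (matrix_inv (X s) ** D ** matrix_inv (X s))) (at s)"
proof -
  have "((\<lambda>h. matrix_inv (X s) ** ((1 / (h - s)) *\<^sub>R (X h - X s)) ** matrix_inv (X h))
      \<longlongrightarrow> matrix_inv (X s) ** D ** matrix_inv (X s)) (at s)"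
    using X inv
    by (intro matrix_mult.tendsto tendsto_const tendsto_matrix_inv has_vector_derivative_tendsto)
       (auto simp: has_vector_derivative_iff_quotient)
  then have "((\<lambda>h. - (matrix_inv (X s) ** ((1 / (h - s)) *\<^sub>R (X h - X s)) ** matrix_inv (X h)))
      \<longlongrightarrow> - (matrix_inv (X s) ** D ** matrix_inv (X s))) (at s)"
    by (rule tendsto_minus)
  also have "(\<lambda>h. - (matrix_inv (X s) ** ((1 / (h - s)) *\<^sub>R (X h - X s)) ** matrix_inv (X h)))
      = (\<lambda>h. (1 / (h - s)) *\<^sub>R (matrix_inv (X h) - matrix_inv (X s)))"
    unfolding matrix_inv_diff[OF inv inv]
    by (simp add: matrix_mult.diff_left matrix_mult.diff_right matrix_mult.scaleR_left matrix_mult.scaleR_right algebra_simps)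
  finally show ?thesis by (simp add: has_vector_derivative_iff_quotient)
qed

text \<open>A factor q over k steps is a rate \<open>root k q\<close> per step. The recurrence is
  asked for from n = 1 on because D^0 is the identity, whose columns need not lie in the kernel of
  v'.\<close>

lemma power_bound_recurrence:
  fixes a :: "nat \<Rightarrow> real"
  assumes "k \<ge> 1" "0 < q" "\<And>n. 0 \<le> a n" "\<And>n. n \<ge> 1 \<Longrightarrow> a (k + n) \<le> q * a n"
  shows "\<exists>C. \<forall>n. a n \<le> C * root k q ^ n"
proof -
  let ?r = "root k q"
  have r: "?r > 0" "?r ^ k = q" using assms by (auto simp: real_root_pow_pos2)
  \<comment> \<open>The constant covers the indices 0 to k; index k belongs to the base, since
    reaching it would take the recurrence at n = 0.\<close>
  define C where "C = (\<Sum>m\<le>k. a m / ?r ^ m)"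
  have "a n \<le> C * ?r ^ n" for n
  proof (induction n rule: less_induct)
    case (less n)
    show ?case
    proof (cases "n \<le> k")
      case True
      then have "a n / ?r ^ n \<le> C"
        unfolding C_def using r assms(3) by (intro member_le_sum) auto
      then show ?thesis using r by (simp add: divide_le_eq)
    next
      case False
      define m where "m = n - k"
      have m: "n = k + m" "m \<ge> 1" "m < n" using False assms(1) by (auto simp: m_def)
      have "a n \<le> q * a m" using assms(4) m by simp
      also have "\<dots> \<le> q * (C * ?r ^ m)" using less m(3) assms(2) by simp
      also have "\<dots> = C * ?r ^ n" by (simp add: m(1) power_add r(2))
      finally show ?thesis .
    qed
  qed
  then show ?thesis by blast
qed

section \<open>Spectral decomposition and perturbation\<close>

context perron
begin

lemma outer_idem: "outer u v ** outer u v = outer u v"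
  by (simp add: matrix_mult_outer outer_mult_vec normalized)

lemma mult_outer: "T ** outer u v = y *\<^sub>R outer u v"
  by (simp add: matrix_mult_outer right_eigen scalar_mult_eq_scaleR outer.scaleR_left)

lemma outer_mult: "outer u v ** T = y *\<^sub>R outer u v"
  by (simp add: outer_matrix_mult left_eigen scalar_mult_eq_scaleR outer.scaleR_right)

text \<open>The form of simplicity of y that is used: on a nonzero such x the matrix T^k would
  multiply the weighted norm by y^k, while the contraction allows at most q < y^k.\<close>

lemma eigenvector_in_kernel_zero:
  assumes "v \<bullet> x = 0" "T *v x = y *s x"
  shows "x = 0"
proof (rule ccontr)
  assume "x \<noteq> 0"
  then obtain i where i: "x $ i \<noteq> 0" by (auto simp: vec_eq_iff)
  obtain k q where kq: "k \<ge> 1" "0 < q" "q < y ^ k"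
    "\<forall>x :: 'm \<Rightarrow> real. (\<Sum>j\<in>UNIV. v $ j *\<^sub>R x j) = 0 \<longrightarrow>
       (\<Sum>i\<in>UNIV. v $ i * norm (\<Sum>j\<in>UNIV. mat_pow T k $ i $ j *\<^sub>R x j))
         \<le> q * (\<Sum>j\<in>UNIV. v $ j * norm (x j))"
    using contraction[where 'b = real] by blast
  let ?N = "\<Sum>j\<in>UNIV. v $ j * \<bar>x $ j\<bar>"
  have "(\<Sum>j\<in>UNIV. mat_pow T k $ i $ j * x $ j) = y ^ k * x $ i" for i
    using arg_cong[OF mat_pow_eigenvector[OF assms(2), of k], of "\<lambda>w. w $ i"]
    by (simp add: matrix_vector_mult_def)
  moreover have "(\<Sum>i\<in>UNIV. v $ i * norm (\<Sum>j\<in>UNIV. mat_pow T k $ i $ j *\<^sub>R x $ j))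
         \<le> q * (\<Sum>j\<in>UNIV. v $ j * norm (x $ j))"
    using kq(4)[rule_format, of "\<lambda>j. x $ j"] assms(1) by (simp add: inner_vec_def)
  ultimately have "y ^ k * ?N \<le> q * ?N"
    using eigenvalue_pos by (simp add: abs_mult sum_distrib_left mult_ac)
  moreover have "0 < ?N" using weighted_norm_pos[of "\<lambda>j. x $ j", OF i] by simp
  ultimately have "y ^ k \<le> q" by (rule mult_right_le_imp_le)
  then show False using kq(3) by simp
qed

text \<open>Adding P removes the kernel of y - T. Multiplying Q x = 0 by v' gives v'x = 0, because
  v'(y - T) = 0 and v'P = v'; what remains is T x = y x with x in the kernel of v'.\<close>

lemma resolvent_invertible: "invertible (y *\<^sub>R mat 1 - T + outer u v)"
proof -
  have "x = 0" if x: "(y *\<^sub>R mat 1 - T + outer u v) *v x = 0" for x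
  proof -
    have Q: "y *\<^sub>R x - T *v x + (v \<bullet> x) *\<^sub>R u = 0"
      using x by (simp add: matrix_vec.add_left matrix_vec.diff_left matrix_vec.scaleR_left outer_mult_vec)
    have "v \<bullet> (T *v x) = y * (v \<bullet> x)"
      using left_eigen by (simp add: dot_lmul_matrix[symmetric] scalar_mult_eq_scaleR)
    then have "v \<bullet> x = v \<bullet> (y *\<^sub>R x - T *v x + (v \<bullet> x) *\<^sub>R u)"
      by (simp add: inner_add_right inner_diff_right normalized)
    then have vx: "v \<bullet> x = 0" using Q by simp
    then show ?thesis using Q eigenvector_in_kernel_zero by (simp add: scalar_mult_eq_scaleR)
  qed
  then show ?thesis by (simp add: invertible_left_inverse matrix_left_invertible_ker)
qed

text \<open>Since v'D = 0, the columns of D^n with n >= 1 lie in the kernel of v', where D and T act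
  alike. So \<open>contraction\<close> applies column by column, and the factor q over k steps
  becomes the rate \<open>root k q\<close> < y.\<close>

lemma deflated_power_bound:
  "\<exists>\<rho> C. 0 < \<rho> \<and> \<rho> < y \<and> (\<forall>n. norm (mat_pow (T - y *\<^sub>R outer u v) n) \<le> C * \<rho> ^ n)"
proof -
  let ?D = "T - y *\<^sub>R outer u v"
  \<comment> \<open>The sum over all columns of the v-weighted l1 norm, in which T^k
    contracts.\<close>
  define N where "N X = (\<Sum>l\<in>UNIV. \<Sum>j\<in>UNIV. v $ j * \<bar>X $ j $ l\<bar>)" for X :: "real ^ 'm ^ 'm"
  obtain k q where kq: "k \<ge> 1" "0 < q" "q < y ^ k"
    "\<forall>x :: 'm \<Rightarrow> real. (\<Sum>j\<in>UNIV. v $ j *\<^sub>R x j) = 0 \<longrightarrow>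
       (\<Sum>i\<in>UNIV. v $ i * norm (\<Sum>j\<in>UNIV. mat_pow T k $ i $ j *\<^sub>R x j))
         \<le> q * (\<Sum>j\<in>UNIV. v $ j * norm (x j))"
    using contraction[where 'b = real] by blast
  have vD: "v v* (?D ** X) = 0" for X
  proof -
    have "v v* ?D = 0"
      using left_eigen normalized
      by (simp add: vector_matrix_mult_diff_rdistrib vector_scaleR_matrix_ac scaleR_vector_matrix_assoc
          vec_mult_outer scalar_mult_eq_scaleR)
    then show ?thesis by (simp add: vector_matrix_mul_assoc[symmetric])
  qed
  have DT: "?D ** X = T ** X" if "v v* X = 0" for X
    using that by (simp add: matrix_mult.diff_left matrix_mult.scaleR_left outer_matrix_mult outer.zero_right)
  have DTk: "mat_pow ?D l ** X = mat_pow T l ** X \<and> v v* (mat_pow T l ** X) = 0"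
    if X: "v v* X = 0" for l and X :: "real ^ 'm ^ 'm"
  proof (induction l)
    case (Suc l)
    have "mat_pow ?D (Suc l) ** X = ?D ** (mat_pow T l ** X)"
      using Suc by (simp add: matrix_mul_assoc[symmetric])
    moreover have "\<dots> = mat_pow T (Suc l) ** X"
      unfolding mat_pow.simps matrix_mul_assoc[symmetric] by (rule DT) (use Suc in simp)
    ultimately show ?case using vD by metis
  qed (use X in simp)
  have N_contract: "N (mat_pow ?D k ** X) \<le> q * N X" if X: "v v* X = 0" for X
  proof -
    have "(\<Sum>j\<in>UNIV. v $ j * \<bar>(mat_pow T k ** X) $ j $ l\<bar>) \<le> q * (\<Sum>j\<in>UNIV. v $ j * \<bar>X $ j $ l\<bar>)" for l
    proof -
      have "(\<Sum>j\<in>UNIV. v $ j * X $ j $ l) = 0"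
        using arg_cong[OF X, of "\<lambda>w. w $ l"] by (simp add: vector_matrix_mult_def mult_ac)
      then show ?thesis
        using kq(4)[rule_format, of "\<lambda>j. X $ j $ l"] by (simp add: matrix_matrix_mult_def)
    qed
    then show ?thesis unfolding DTk[OF X, THEN conjunct1] N_def sum_distrib_left
      by (rule sum_mono)
  qed
  have N_nonneg: "0 \<le> N X" for X
    unfolding N_def using v_pos by (auto intro!: sum_nonneg simp: less_imp_le)
  have "N (mat_pow ?D (k + n)) \<le> q * N (mat_pow ?D n)" if "n \<ge> 1" for n
  proof -
    obtain m where "n = Suc m" using \<open>n \<ge> 1\<close> by (cases n) auto
    then have "v v* mat_pow ?D n = 0" using vD by simp
    then show ?thesis using N_contract by (simp add: mat_pow_add)
  qed
  then obtain C where C: "\<And>n. N (mat_pow ?D n) \<le> C * root k q ^ n"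
    using power_bound_recurrence[of k q "\<lambda>n. N (mat_pow ?D n)"] kq(1,2) N_nonneg by blast
  \<comment> \<open>Undoes the weights when returning to the Euclidean norm: 1 / v_j <= c for every
    j.\<close>
  define c where "c = (\<Sum>i\<in>UNIV. 1 / v $ i)"
  have "norm X \<le> c * N X" for X
  proof -
    have "\<bar>X $ j $ l\<bar> \<le> c * (v $ j * \<bar>X $ j $ l\<bar>)" for j l
    proof -
      have "1 / v $ j \<le> c" unfolding c_def using v_pos by (intro member_le_sum) (auto simp: less_imp_le)
      then have "1 / v $ j * (v $ j * \<bar>X $ j $ l\<bar>) \<le> c * (v $ j * \<bar>X $ j $ l\<bar>)"
        using v_pos[of j] by (intro mult_right_mono) auto
      then show ?thesis using v_pos[of j] by simp
    qed
    then have "(\<Sum>j\<in>UNIV. \<Sum>l\<in>UNIV. \<bar>X $ j $ l\<bar>) \<le> (\<Sum>j\<in>UNIV. \<Sum>l\<in>UNIV. c * (v $ j * \<bar>X $ j $ l\<bar>))"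
      by (intro sum_mono)
    also have "\<dots> = c * N X" unfolding N_def sum_distrib_left by (rule sum.swap)
    finally have "(\<Sum>j\<in>UNIV. \<Sum>l\<in>UNIV. \<bar>X $ j $ l\<bar>) \<le> c * N X" .
    moreover have "norm X \<le> (\<Sum>j\<in>UNIV. norm (X $ j))"
      unfolding norm_vec_def by (rule L2_set_le_sum) simp
    moreover have "(\<Sum>j\<in>UNIV. norm (X $ j)) \<le> (\<Sum>j\<in>UNIV. \<Sum>l\<in>UNIV. \<bar>X $ j $ l\<bar>)"
      by (intro sum_mono norm_le_l1_cart)
    ultimately show ?thesis by linarith
  qed
  moreover have "c \<ge> 0" unfolding c_def using v_pos by (intro sum_nonneg) (simp add: less_imp_le)
  ultimately have "norm (mat_pow ?D n) \<le> c * C * root k q ^ n" for n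
    using mult_left_mono[OF C[of n], of c] by (metis mult.assoc order_trans)
  moreover have "0 < root k q" using kq by simp
  moreover have "root k q < y"
  proof (rule power_less_imp_less_base)
    show "root k q ^ k < y ^ k" using kq by (simp add: real_root_pow_pos2)
  qed (use eigenvalue_pos in simp)
  ultimately show ?thesis by blast
qed

text \<open>Positivity leaves no cancellation in v'w = 1, so each v_i w_i is at most 1. This bounds
  perturbed eigenvectors uniformly.\<close>

lemma normalized_eigen_bounded:
  assumes "\<And>i. 0 < w $ i" "v \<bullet> w = 1"
  shows "norm w \<le> (\<Sum>i\<in>UNIV. 1 / v $ i)"
proof -
  have "\<bar>w $ i\<bar> \<le> 1 / v $ i" for i
  proof -
    have "v $ i * w $ i \<le> (\<Sum>j\<in>UNIV. v $ j * w $ j)"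
      using v_pos assms(1) by (intro member_le_sum) (auto simp: less_imp_le)
    then show ?thesis using assms v_pos[of i] by (simp add: inner_vec_def le_divide_eq mult_ac abs_of_pos)
  qed
  then show ?thesis by (intro order_trans[OF norm_le_l1_cart] sum_mono)
qed

text \<open>The perturbed eigenvectors are rescaled against the fixed \<open>v\<close>, since the
  pairs (\<open>v' s\<close>, \<open>u' s\<close>) may be scaled differently for each
  \<open>s\<close>. Pairing the eigenvector equation with \<open>v\<close> expresses
  \<open>y' s - y\<close> through \<open>T' s - T\<close>, and boundedness of \<open>w\<close> makes
  it tend to 0.\<close>

lemma tendsto_perron_right:
  assumes T': "(T' \<longlongrightarrow> T) F" and p: "\<And>s. perron (T' s) (v' s) (u' s) (y' s)"
  shows "(y' \<longlongrightarrow> y) F" "((\<lambda>s. (1 / (v \<bullet> u' s)) *\<^sub>R u' s) \<longlongrightarrow> u) F"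
proof -
  define w where "w s = (1 / (v \<bullet> u' s)) *\<^sub>R u' s" for s
  have vu: "0 < v \<bullet> u' s" for s
    unfolding inner_vec_def using v_pos perron.u_pos[OF p] by (intro sum_pos) auto
  have w_pos: "0 < w s $ i" for s i using vu perron.u_pos[OF p] by (simp add: w_def)
  have vw: "v \<bullet> w s = 1" for s using vu[of s] by (simp add: w_def)
  have eig: "T' s *v w s = y' s *\<^sub>R w s" for s
    using perron.right_eigen[OF p, of s] by (simp add: w_def matrix_vec.scaleR_right scalar_mult_eq_scaleR)
  have "Bfun w F" by (rule BfunI[OF always_eventually]) (use normalized_eigen_bounded[OF w_pos vw] in blast)
  then have Z: "Zfun (\<lambda>s. (T' s - T) *v w s) F"
    using T' by (intro matrix_vec.Zfun_prod_Bfun) (simp_all add: tendsto_Zfun_iff)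
  have "v \<bullet> ((T' s - T) *v w s) = y' s - y" for s
  proof -
    have "v \<bullet> (T *v w s) = y"
      using left_eigen vw by (simp add: dot_lmul_matrix[symmetric] scalar_mult_eq_scaleR)
    then show ?thesis by (simp add: matrix_vec.diff_left inner_diff_right eig vw)
  qed
  then have Zy: "Zfun (\<lambda>s. y' s - y) F"
    using bounded_linear.Zfun[OF bounded_linear_inner_right[of v] Z] by simp
  then show "(y' \<longlongrightarrow> y) F" by (simp add: tendsto_Zfun_iff)
  let ?Q = "y *\<^sub>R mat 1 - T + outer u v"
  \<comment> \<open>The P-part of Q annihilates w - u, as both vectors pair to 1 with v; what is
    left is y w - T w, rewritten with the perturbed eigenvector equation. Inverting Q then controls
    w - u.\<close>
  have Qw: "?Q *v (w s - u) = (T' s - T) *v w s - (y' s - y) *\<^sub>R w s" for s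
    using right_eigen
    by (simp add: matrix_vec.add_left matrix_vec.diff_left matrix_vec.diff_right matrix_vec.scaleR_left
        outer_mult_vec vw normalized eig scalar_mult_eq_scaleR inner_diff_right algebra_simps)
  have "w s - u = matrix_inv ?Q *v ((T' s - T) *v w s - (y' s - y) *\<^sub>R w s)" for s
    unfolding Qw[symmetric] by (simp add: matrix_vector_mul_assoc matrix_inv_left[OF resolvent_invertible])
  moreover have "Zfun (\<lambda>s. matrix_inv ?Q *v ((T' s - T) *v w s - (y' s - y) *\<^sub>R w s)) F"
    by (intro matrix_vec.Zfun_right Zfun_diff[OF Z]
        bounded_bilinear.Zfun_prod_Bfun[OF bounded_bilinear_scaleR Zy] \<open>Bfun w F\<close>)
  ultimately have "Zfun (\<lambda>s. w s - u) F" by simp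
  then show "((\<lambda>s. (1 / (v \<bullet> u' s)) *\<^sub>R u' s) \<longlongrightarrow> u) F"
    by (simp add: tendsto_Zfun_iff w_def)
qed

text \<open>Right and left vectors are known to converge only after separate rescaling, to
  \<open>w\<close> and \<open>z\<close>. Dividing their outer product by z'w cancels both scalings,
  because each perturbed pair is normalized.\<close>

lemma tendsto_perron_outer:
  assumes T': "(T' \<longlongrightarrow> T) F" and p: "\<And>s. perron (T' s) (v' s) (u' s) (y' s)"
  shows "((\<lambda>s. outer (u' s) (v' s)) \<longlongrightarrow> outer u v) F"
proof -
  define w where "w s = (1 / (v \<bullet> u' s)) *\<^sub>R u' s" for s
  define z where "z s = (1 / (u \<bullet> v' s)) *\<^sub>R v' s" for s
  have "bounded_linear (transpose :: real ^ 'm ^ 'm \<Rightarrow> _)"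
    unfolding linear_conv_bounded_linear[symmetric]
    by (rule linearI) (simp_all add: vec_eq_iff transpose_def)
  then have tT: "((\<lambda>s. transpose (T' s)) \<longlongrightarrow> transpose T) F"
    using T' bounded_linear.tendsto by blast
  have w: "(w \<longlongrightarrow> u) F" unfolding w_def using tendsto_perron_right[OF T' p] by simp
  have z: "(z \<longlongrightarrow> v) F"
    unfolding z_def using perron.tendsto_perron_right[OF transposed tT perron.transposed[OF p]] by simp
  have "((\<lambda>s. (1 / (z s \<bullet> w s)) *\<^sub>R outer (w s) (z s)) \<longlongrightarrow> (1 / (v \<bullet> u)) *\<^sub>R outer u v) F"
    using w z normalized by (intro tendsto_intros outer.tendsto) auto
  moreover have "(1 / (z s \<bullet> w s)) *\<^sub>R outer (w s) (z s) = outer (u' s) (v' s)" for s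
  proof -
    have "0 < v \<bullet> u' s"
      unfolding inner_vec_def using v_pos perron.u_pos[OF p] by (intro sum_pos) auto
    moreover have "0 < u \<bullet> v' s"
      unfolding inner_vec_def using u_pos perron.v_pos[OF p] by (intro sum_pos) auto
    ultimately show ?thesis
      using perron.normalized[OF p, of s]
      by (simp add: w_def z_def outer.scaleR_left outer.scaleR_right)
  qed
  ultimately show ?thesis by (simp add: normalized)
qed

end

text \<open>P D = 0 removes the mixed terms. The exponent starts at 1, since at 0 the right-hand
  side would be P + I.\<close>

lemma (in perron) mat_pow_spectral:
  "mat_pow T (Suc n) = y ^ Suc n *\<^sub>R outer u v + mat_pow (T - y *\<^sub>R outer u v) (Suc n)"
proof (induction n)
  case (Suc n)
  let ?D = "T - y *\<^sub>R outer u v"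
  have "outer u v ** ?D = 0"
    by (simp add: matrix_mult.diff_right matrix_mult.scaleR_right outer_idem outer_mult)
  then have PD: "outer u v ** mat_pow ?D (Suc n) = 0"
    by (simp add: matrix_mul_assoc)
  have "mat_pow T (Suc (Suc n)) = T ** (y ^ Suc n *\<^sub>R outer u v + mat_pow ?D (Suc n))"
    using Suc by simp
  also have "\<dots> = y ^ Suc (Suc n) *\<^sub>R outer u v + T ** mat_pow ?D (Suc n)"
    by (simp add: matrix_mult.add_right matrix_mult.scaleR_right mult_outer mult_ac del: mat_pow.simps)
  also have "T ** mat_pow ?D (Suc n) = ?D ** mat_pow ?D (Suc n)"
    using PD by (simp add: matrix_mult.diff_left matrix_mult.scaleR_left del: mat_pow.simps)
  finally show ?case by simp
qed simp

definition pf_proj :: "real ^ 'm::finite ^ 'm \<Rightarrow> real ^ 'm ^ 'm" where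
  "pf_proj T = outer (pf_right T) (pf_left T)"

text \<open>The inverted matrix is the identity on the range of P and y - T on the kernel of v'; the
  inverse is thus the reduced resolvent at y plus P.\<close>

definition pf_resolvent :: "real ^ 'm::finite ^ 'm \<Rightarrow> real ^ 'm ^ 'm" where
  "pf_resolvent T = matrix_inv (pf_eigenvalue T *\<^sub>R mat 1 - T + pf_proj T)"

lemma pf_proj_facts:
  fixes T :: "real ^ 'm::finite ^ 'm"
  assumes "primitive_mat T"
  shows pf_proj_idem: "pf_proj T ** pf_proj T = pf_proj T"
    and mult_pf_proj: "T ** pf_proj T = pf_eigenvalue T *\<^sub>R pf_proj T"
    and pf_proj_mult: "pf_proj T ** T = pf_eigenvalue T *\<^sub>R pf_proj T"
    and trace_pf_proj: "trace (pf_proj T) = 1"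
    and pf_eigenvalue_pos: "0 < pf_eigenvalue T"
    and pf_resolvent_invertible: "invertible (pf_eigenvalue T *\<^sub>R mat 1 - T + pf_proj T)"
proof -
  interpret perron T "pf_left T" "pf_right T" "pf_eigenvalue T" using perron_pf[OF assms] .
  show "pf_proj T ** pf_proj T = pf_proj T" "T ** pf_proj T = pf_eigenvalue T *\<^sub>R pf_proj T"
    "pf_proj T ** T = pf_eigenvalue T *\<^sub>R pf_proj T" "trace (pf_proj T) = 1" "0 < pf_eigenvalue T"
    "invertible (pf_eigenvalue T *\<^sub>R mat 1 - T + pf_proj T)"
    using outer_idem mult_outer outer_mult normalized eigenvalue_pos resolvent_invertible
    by (simp_all add: pf_proj_def trace_outer)
qed

section \<open>Eigenvalue, projection and resolvent along curves of primitive matrices\<close>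

lemma tendsto_pf_eigenvalue:
  assumes "(X \<longlongrightarrow> T) F" "primitive_mat T" "\<And>s. primitive_mat (X s)"
  shows "((\<lambda>s. pf_eigenvalue (X s)) \<longlongrightarrow> pf_eigenvalue T) F"
  using perron.tendsto_perron_right(1)[OF perron_pf[OF assms(2)] assms(1) perron_pf[OF assms(3)]] .

lemma tendsto_pf_proj:
  assumes "(X \<longlongrightarrow> T) F" "primitive_mat T" "\<And>s. primitive_mat (X s)"
  shows "((\<lambda>s. pf_proj (X s)) \<longlongrightarrow> pf_proj T) F"
  unfolding pf_proj_def
  using perron.tendsto_perron_outer[OF perron_pf[OF assms(2)] assms(1) perron_pf[OF assms(3)]] .

lemma tendsto_pf_resolvent:
  assumes "(X \<longlongrightarrow> T) F" "primitive_mat T" "\<And>s. primitive_mat (X s)"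
  shows "((\<lambda>s. pf_resolvent (X s)) \<longlongrightarrow> pf_resolvent T) F"
  unfolding pf_resolvent_def
  by (intro tendsto_matrix_inv tendsto_intros tendsto_pf_eigenvalue tendsto_pf_proj
      pf_resolvent_invertible assms)

text \<open>Sandwiching the increment of the curve between the two projections isolates the increment
  of the eigenvalue, because \<open>P X = y P\<close> on the left and \<open>X P = y P\<close> on the right.\<close>

lemma has_vector_derivative_pf_eigenvalue:
  fixes X :: "real \<Rightarrow> real ^ 'm::finite ^ 'm"
  assumes X: "(X has_vector_derivative D) (at s)" and prim: "\<And>s. primitive_mat (X s)"
  shows "((\<lambda>s. pf_eigenvalue (X s)) has_vector_derivative
           trace (pf_proj (X s) ** D ** pf_proj (X s))) (at s)"
proof -
  let ?P = "\<lambda>h. pf_proj (X h)" and ?y = "\<lambda>h. pf_eigenvalue (X h)"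
  note X_lim = has_vector_derivative_tendsto[OF X]
  have P_lim: "(?P \<longlongrightarrow> ?P s) (at s)" by (intro tendsto_pf_proj prim X_lim)
  note tr_lim = bounded_linear.tendsto[OF bounded_linear_trace]
  \<comment> \<open>The trace turns the sandwiched identity into a scalar one; its factor tr (P_s
    P_h) tends to tr P_s = 1, which permits division near s.\<close>
  have "((\<lambda>h. trace (?P s ** ?P h)) \<longlongrightarrow> trace (?P s ** ?P s)) (at s)"
    by (intro tr_lim matrix_mult.tendsto tendsto_const P_lim)
  then have c_lim: "((\<lambda>h. trace (?P s ** ?P h)) \<longlongrightarrow> 1) (at s)"
    by (simp add: pf_proj_idem trace_pf_proj prim)
  have "((\<lambda>h. trace (?P s ** ((1 / (h - s)) *\<^sub>R (X h - X s)) ** ?P h)) \<longlongrightarrow> trace (?P s ** D ** ?P s)) (at s)"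
    by (intro tr_lim matrix_mult.tendsto tendsto_const P_lim)
       (use X in \<open>simp add: has_vector_derivative_iff_quotient\<close>)
  then have "((\<lambda>h. trace (?P s ** ((1 / (h - s)) *\<^sub>R (X h - X s)) ** ?P h) / trace (?P s ** ?P h))
      \<longlongrightarrow> trace (?P s ** D ** ?P s) / 1) (at s)"
    by (intro tendsto_divide c_lim) simp_all
  moreover have "\<forall>\<^sub>F h in at s. trace (?P s ** ((1 / (h - s)) *\<^sub>R (X h - X s)) ** ?P h) / trace (?P s ** ?P h)
      = (1 / (h - s)) *\<^sub>R (?y h - ?y s)"
  proof -
    have "\<forall>\<^sub>F h in at s. 0 < trace (?P s ** ?P h)" using c_lim by (rule order_tendstoD) simp
    then show ?thesis
    proof eventually_elim
      case (elim h)
      have "?P s ** (X h - X s) ** ?P h = ?P s ** (X h ** ?P h) - (?P s ** X s) ** ?P h"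
        by (simp add: matrix_mult.diff_left matrix_mult.diff_right matrix_mul_assoc)
      also have "\<dots> = (?y h - ?y s) *\<^sub>R (?P s ** ?P h)"
        by (simp add: mult_pf_proj pf_proj_mult prim matrix_mult.scaleR_left matrix_mult.scaleR_right scaleR_diff_left)
      finally show ?case
        using elim
        by (simp add: matrix_mult.scaleR_left matrix_mult.scaleR_right bounded_linear_trace
            linear_simps(5)[OF bounded_linear_trace])
    qed
  qed
  ultimately show ?thesis
    unfolding has_vector_derivative_iff_quotient by (auto dest: Lim_transform_eventually)
qed

text \<open>E is the increment of the matrix minus its eigenvalue. Expanding Q_T P_S and P_T Q_S and
  applying the resolvents expresses P_S and P_T with the common term P_T P_S, which drops out of the
  difference. The identity is exact, so given the derivative of y, the derivative of P takes only
  continuity of P and R.\<close>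

lemma pf_proj_diff:
  fixes S T :: "real ^ 'm::finite ^ 'm"
  assumes "primitive_mat S" "primitive_mat T"
  defines "E \<equiv> (S - T) - (pf_eigenvalue S - pf_eigenvalue T) *\<^sub>R mat 1"
  shows "pf_proj S - pf_proj T = pf_resolvent T ** E ** pf_proj S + pf_proj T ** E ** pf_resolvent S"
proof -
  let ?Q = "\<lambda>X. pf_eigenvalue X *\<^sub>R mat 1 - X + pf_proj X"
  note simps = matrix_mult.diff_left matrix_mult.diff_right matrix_mult.add_left matrix_mult.add_right
    matrix_mult.scaleR_left matrix_mult.scaleR_right
  have inv: "invertible (?Q S)" "invertible (?Q T)" using assms pf_resolvent_invertible by blast+
  \<comment> \<open>Next to P, on either side, Q acts as the identity; hence so does its
    inverse.\<close>
  have QP: "?Q T ** pf_proj T = pf_proj T" "pf_proj S ** ?Q S = pf_proj S"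
    by (simp_all add: simps mult_pf_proj pf_proj_mult pf_proj_idem assms)
  have "pf_resolvent T ** pf_proj T = pf_resolvent T ** (?Q T ** pf_proj T)" by (simp only: QP)
  then have RP: "pf_resolvent T ** pf_proj T = pf_proj T"
    by (simp only: matrix_mul_assoc pf_resolvent_def matrix_inv_left[OF inv(2)] matrix_mul_lid)
  have "pf_proj S ** pf_resolvent S = (pf_proj S ** ?Q S) ** pf_resolvent S" by (simp only: QP)
  then have PR: "pf_proj S ** pf_resolvent S = pf_proj S"
    by (simp only: matrix_mul_assoc[symmetric] pf_resolvent_def matrix_inv_right[OF inv(1)] matrix_mul_rid)
  have "?Q T ** pf_proj S = E ** pf_proj S + pf_proj T ** pf_proj S"
    by (simp add: E_def simps mult_pf_proj assms scaleR_diff_left)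
  then have "pf_resolvent T ** (?Q T ** pf_proj S) = pf_resolvent T ** (E ** pf_proj S) + (pf_resolvent T ** pf_proj T) ** pf_proj S"
    by (simp add: matrix_mult.add_right matrix_mul_assoc)
  moreover have "pf_resolvent T ** (?Q T ** pf_proj S) = pf_proj S"
    by (simp only: matrix_mul_assoc pf_resolvent_def matrix_inv_left[OF inv(2)] matrix_mul_lid)
  ultimately have 1: "pf_proj S = pf_resolvent T ** E ** pf_proj S + pf_proj T ** pf_proj S"
    by (simp add: RP matrix_mul_assoc)
  have "pf_proj T ** ?Q S = pf_proj T ** pf_proj S - pf_proj T ** E"
    by (simp add: E_def simps pf_proj_mult assms scaleR_diff_left)
  then have "(pf_proj T ** ?Q S) ** pf_resolvent S = pf_proj T ** (pf_proj S ** pf_resolvent S) - pf_proj T ** E ** pf_resolvent S"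
    by (simp add: matrix_mult.diff_left matrix_mul_assoc)
  moreover have "(pf_proj T ** ?Q S) ** pf_resolvent S = pf_proj T"
    by (simp only: matrix_mul_assoc[symmetric] pf_resolvent_def matrix_inv_right[OF inv(1)] matrix_mul_rid)
  ultimately have 2: "pf_proj T = pf_proj T ** pf_proj S - pf_proj T ** E ** pf_resolvent S"
    by (simp add: PR)
  show ?thesis using arg_cong2[where f = minus, OF 1 2] by simp
qed

lemma has_vector_derivative_pf_proj:
  fixes X :: "real \<Rightarrow> real ^ 'm::finite ^ 'm"
  assumes X: "(X has_vector_derivative D) (at s)" and prim: "\<And>s. primitive_mat (X s)"
  defines "P \<equiv> pf_proj (X s)" and "R \<equiv> pf_resolvent (X s)"
  defines "E \<equiv> D - trace (P ** D ** P) *\<^sub>R mat 1"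
  shows "((\<lambda>s. pf_proj (X s)) has_vector_derivative R ** E ** P + P ** E ** R) (at s)"
proof -
  let ?y = "\<lambda>h. pf_eigenvalue (X h)"
  let ?q = "\<lambda>h. (1 / (h - s)) *\<^sub>R (X h - X s) - ((1 / (h - s)) *\<^sub>R (?y h - ?y s)) *\<^sub>R mat 1"
  note X_lim = has_vector_derivative_tendsto[OF X]
  have "(?q \<longlongrightarrow> E) (at s)"
    unfolding E_def P_def
    using X has_vector_derivative_pf_eigenvalue[OF X prim]
    by (intro tendsto_intros) (simp_all only: has_vector_derivative_iff_quotient)
  then have "((\<lambda>h. R ** ?q h ** pf_proj (X h) + P ** ?q h ** pf_resolvent (X h)) \<longlongrightarrow> R ** E ** P + P ** E ** R) (at s)"
    unfolding P_def R_def
    by (intro tendsto_add matrix_mult.tendsto tendsto_const tendsto_pf_proj tendsto_pf_resolvent prim X_lim)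
  moreover have "R ** ?q h ** pf_proj (X h) + P ** ?q h ** pf_resolvent (X h)
      = (1 / (h - s)) *\<^sub>R (pf_proj (X h) - pf_proj (X s))" for h
    unfolding pf_proj_diff[OF prim prim] P_def R_def
    by (simp add: matrix_mult.scaleR_left matrix_mult.scaleR_right matrix_mult.diff_left
        matrix_mult.diff_right scaleR_add_right scaleR_diff_right)
  ultimately show ?thesis by (simp add: has_vector_derivative_iff_quotient)
qed

section \<open>Partial derivatives\<close>

text \<open>\<open>deriv\<close> is total and returns a value even where no derivative exists, so
  the calculus uses a relation and passes to \<open>partial_deriv\<close> at the end. Vector values
  are allowed because matrices are differentiated.\<close>

definition has_partial ::
    "(real ^ 'l::finite \<Rightarrow> 'a::real_normed_vector) \<Rightarrow> 'a \<Rightarrow> 'l \<Rightarrow> real ^ 'l \<Rightarrow> bool" where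
  "has_partial f d j t \<longleftrightarrow> ((\<lambda>s. f (t + s *\<^sub>R axis j 1)) has_vector_derivative d) (at 0)"

text \<open>For second-order terms existence suffices: their values are named when needed, without a
  formula.\<close>

definition partially_differentiable ::
    "(real ^ 'l::finite \<Rightarrow> 'a::real_normed_vector) \<Rightarrow> 'l \<Rightarrow> real ^ 'l \<Rightarrow> bool" where
  "partially_differentiable f j t \<longleftrightarrow> (\<exists>d. has_partial f d j t)"

lemma has_partial_partial_deriv: "has_partial f d j t \<Longrightarrow> partial_deriv j f t = d"
  unfolding has_partial_def partial_deriv_def has_real_derivative_iff_has_vector_derivative[symmetric]
  by (rule DERIV_imp_deriv)

lemma has_partial_unique: "has_partial f d j t \<Longrightarrow> has_partial f d' j t \<Longrightarrow> d = d'"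
  unfolding has_partial_def by (rule vector_derivative_unique_at)

lemma has_partial_const: "has_partial (\<lambda>_. c) 0 j t"
  by (simp add: has_partial_def)

lemma has_partial_add:
  "has_partial f d j t \<Longrightarrow> has_partial g e j t \<Longrightarrow> has_partial (\<lambda>t. f t + g t) (d + e) j t"
  unfolding has_partial_def by (rule has_vector_derivative_add)

lemma has_partial_diff:
  "has_partial f d j t \<Longrightarrow> has_partial g e j t \<Longrightarrow> has_partial (\<lambda>t. f t - g t) (d - e) j t"
  unfolding has_partial_def by (rule has_vector_derivative_diff)

lemma has_partial_sum:
  "(\<And>w. w \<in> W \<Longrightarrow> has_partial (f w) (d w) j t) \<Longrightarrow> has_partial (\<lambda>t. \<Sum>w\<in>W. f w t) (\<Sum>w\<in>W. d w) j t"
  unfolding has_partial_def by (rule has_vector_derivative_sum)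

lemma has_partial_linear:
  "bounded_linear L \<Longrightarrow> has_partial f d j t \<Longrightarrow> has_partial (\<lambda>t. L (f t)) (L d) j t"
  unfolding has_partial_def by (rule bounded_linear.has_vector_derivative)

lemma has_partial_bilinear:
  assumes "bounded_bilinear mul" "has_partial f d j t" "has_partial g e j t"
  shows "has_partial (\<lambda>t. mul (f t) (g t)) (mul (f t) e + mul d (g t)) j t"
  using bounded_bilinear.has_vector_derivative[OF assms(1) assms(2,3)[unfolded has_partial_def]]
  by (simp add: has_partial_def)

lemmas has_partial_matrix_mult = has_partial_bilinear[OF bounded_bilinear_matrix_mult]
lemmas has_partial_scaleR = has_partial_bilinear[OF bounded_bilinear_scaleR]

lemma has_partial_exp:
  fixes f :: "real ^ 'l::finite \<Rightarrow> real"
  assumes "has_partial f d j t"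
  shows "has_partial (\<lambda>t. exp (f t)) (exp (f t) * d) j t"
proof -
  have "((\<lambda>s. f (t + s *\<^sub>R axis j 1)) has_real_derivative d) (at 0)"
    using assms by (simp add: has_partial_def has_real_derivative_iff_has_vector_derivative)
  from DERIV_fun_exp[OF this] show ?thesis
    by (simp add: has_partial_def has_real_derivative_iff_has_vector_derivative)
qed

lemma has_partial_power:
  fixes f :: "real ^ 'l::finite \<Rightarrow> real"
  assumes "has_partial f d j t"
  shows "has_partial (\<lambda>t. f t ^ n) (real n * f t ^ (n - 1) * d) j t"
proof -
  have "((\<lambda>s. f (t + s *\<^sub>R axis j 1)) has_real_derivative d) (at 0)"
    using assms by (simp add: has_partial_def has_real_derivative_iff_has_vector_derivative)
  from DERIV_power[OF this, of n] show ?thesis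
    by (simp add: has_partial_def has_real_derivative_iff_has_vector_derivative mult_ac)
qed

lemma has_partial_ln:
  fixes f :: "real ^ 'l::finite \<Rightarrow> real"
  assumes "has_partial f d j t" "0 < f t"
  shows "has_partial (\<lambda>t. ln (f t)) (d / f t) j t"
proof -
  have "((\<lambda>s. f (t + s *\<^sub>R axis j 1)) has_real_derivative d) (at 0)"
    using assms by (simp add: has_partial_def has_real_derivative_iff_has_vector_derivative)
  then have "((\<lambda>s. ln (f (t + s *\<^sub>R axis j 1))) has_real_derivative 1 / f t * d) (at 0)"
    using assms(2) DERIV_ln_divide[of "f t"]
    by (intro DERIV_chain2[where f = ln and g = "\<lambda>s. f (t + s *\<^sub>R axis j 1)"]) simp_all
  then show ?thesis
    by (simp add: has_partial_def has_real_derivative_iff_has_vector_derivative)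
qed

lemma has_partial_divide:
  fixes f g :: "real ^ 'l::finite \<Rightarrow> real"
  assumes "has_partial f d j t" "has_partial g e j t" "g t \<noteq> 0"
  shows "has_partial (\<lambda>t. f t / g t) ((d * g t - f t * e) / (g t * g t)) j t"
  using assms DERIV_divide[of "\<lambda>s. f (t + s *\<^sub>R axis j 1)" d 0 UNIV "\<lambda>s. g (t + s *\<^sub>R axis j 1)" e]
  by (simp add: has_partial_def has_real_derivative_iff_has_vector_derivative)

lemma has_partial_nth: "has_partial (\<lambda>t. t $ i) (if i = j then 1 else 0) j t"
  unfolding has_partial_def
  by (auto simp: axis_def has_real_derivative_iff_has_vector_derivative[symmetric] intro!: derivative_eq_intros)

section \<open>Spectral data of a family of primitive matrices\<close>

context
  fixes f :: "real ^ 'l::finite \<Rightarrow> real ^ 'm::finite ^ 'm"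
  assumes prim: "\<And>t. primitive_mat (f t)"
begin

lemma has_partial_pf_eigenvalue:
  "has_partial f d j t \<Longrightarrow>
    has_partial (\<lambda>t. pf_eigenvalue (f t)) (trace (pf_proj (f t) ** d ** pf_proj (f t))) j t"
  using has_vector_derivative_pf_eigenvalue[of "\<lambda>s. f (t + s *\<^sub>R axis j 1)" d 0] prim
  by (simp add: has_partial_def)

lemma has_partial_pf_proj:
  "has_partial f d j t \<Longrightarrow>
    has_partial (\<lambda>t. pf_proj (f t))
      (pf_resolvent (f t) ** (d - trace (pf_proj (f t) ** d ** pf_proj (f t)) *\<^sub>R mat 1) ** pf_proj (f t)
        + pf_proj (f t) ** (d - trace (pf_proj (f t) ** d ** pf_proj (f t)) *\<^sub>R mat 1) ** pf_resolvent (f t)) j t"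
  using has_vector_derivative_pf_proj[of "\<lambda>s. f (t + s *\<^sub>R axis j 1)" d 0] prim
  by (simp add: has_partial_def)

text \<open>There is no circularity: differentiating P took only continuity of R, so R, as the
  inverse of y - f + P, can be differentiated afterwards.\<close>

lemma partially_differentiable_pf_resolvent:
  assumes "has_partial f d j t"
  shows "partially_differentiable (\<lambda>t. pf_resolvent (f t)) j t"
proof -
  have "\<exists>D. has_partial (\<lambda>t. pf_eigenvalue (f t) *\<^sub>R mat 1 - f t + pf_proj (f t)) D j t"
    using has_partial_add[OF has_partial_diff[OF has_partial_scaleR[OF has_partial_pf_eigenvalue[OF assms]
          has_partial_const] assms] has_partial_pf_proj[OF assms]] by blast
  then show ?thesis
    unfolding partially_differentiable_def has_partial_def pf_resolvent_def
    using has_vector_derivative_matrix_inv[of "\<lambda>s. pf_eigenvalue (f (t + s *\<^sub>R axis j 1)) *\<^sub>R mat 1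
        - f (t + s *\<^sub>R axis j 1) + pf_proj (f (t + s *\<^sub>R axis j 1))" _ 0] pf_resolvent_invertible[OF prim]
    by blast
qed

end

section \<open>Closure rules for existence of partial derivatives\<close>

lemma partially_differentiable_add:
  "partially_differentiable f j t \<Longrightarrow> partially_differentiable g j t \<Longrightarrow> partially_differentiable (\<lambda>t. f t + g t) j t"
  unfolding partially_differentiable_def using has_partial_add by blast

lemma partially_differentiable_diff:
  "partially_differentiable f j t \<Longrightarrow> partially_differentiable g j t \<Longrightarrow> partially_differentiable (\<lambda>t. f t - g t) j t"
  unfolding partially_differentiable_def using has_partial_diff by blast

lemma partially_differentiable_const: "partially_differentiable (\<lambda>_. c) j t"
  unfolding partially_differentiable_def using has_partial_const by blast

lemma partially_differentiable_matrix_mult: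
  fixes f :: "real ^ 'l::finite \<Rightarrow> real ^ 'n::finite ^ 'm::finite" and g :: "real ^ 'l \<Rightarrow> real ^ 'p::finite ^ 'n"
  shows "partially_differentiable f j t \<Longrightarrow> partially_differentiable g j t \<Longrightarrow> partially_differentiable (\<lambda>t. f t ** g t) j t"
  unfolding partially_differentiable_def using has_partial_matrix_mult by blast

lemma partially_differentiable_scaleR:
  fixes f :: "real ^ 'l::finite \<Rightarrow> real" and g :: "real ^ 'l \<Rightarrow> 'a::real_normed_vector"
  shows "partially_differentiable f j t \<Longrightarrow> partially_differentiable g j t \<Longrightarrow> partially_differentiable (\<lambda>t. f t *\<^sub>R g t) j t"
  unfolding partially_differentiable_def using has_partial_scaleR by blast

lemma partially_differentiable_trace:
  fixes f :: "real ^ 'l::finite \<Rightarrow> real ^ 'm::finite ^ 'm"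
  shows "partially_differentiable f j t \<Longrightarrow> partially_differentiable (\<lambda>t. trace (f t)) j t"
  unfolding partially_differentiable_def using has_partial_linear[OF bounded_linear_trace] by blast

section \<open>Tilted matrices and generating functions of words\<close>

lemma mat_pow_mono_scaled:
  fixes S T :: "real ^ 'm::finite ^ 'm"
  assumes "nonneg_mat S" "nonneg_mat T" "0 \<le> c" "\<And>i j. c * S $ i $ j \<le> T $ i $ j"
  shows "c ^ k * mat_pow S k $ i $ j \<le> mat_pow T k $ i $ j"
proof (induction k arbitrary: i j)
  case (Suc k)
  have "c ^ Suc k * mat_pow S (Suc k) $ i $ j = (\<Sum>l\<in>UNIV. (c * S $ i $ l) * (c ^ k * mat_pow S k $ l $ j))"
    by (simp add: matrix_matrix_mult_def sum_distrib_left mult_ac)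
  also have "\<dots> \<le> (\<Sum>l\<in>UNIV. T $ i $ l * mat_pow T k $ l $ j)"
    using assms Suc mat_pow_nonneg[OF assms(1)]
    by (intro sum_mono mult_mono) (auto simp: nonneg_mat_def)
  finally show ?case by (simp add: matrix_matrix_mult_def)
qed simp

lemma primitive_scaled:
  fixes S T :: "real ^ 'm::finite ^ 'm"
  assumes "primitive_mat S" "nonneg_mat T" "0 < c" "\<And>i j. c * S $ i $ j \<le> T $ i $ j"
  shows "primitive_mat T"
proof -
  obtain k where k: "k \<ge> 1" "\<And>i j. 0 < mat_pow S k $ i $ j" using assms(1) by (auto simp: primitive_mat_def)
  have "0 < mat_pow T k $ i $ j" for i j
  proof -
    have "0 < c ^ k * mat_pow S k $ i $ j" using k assms(3) by simp
    also have "\<dots> \<le> mat_pow T k $ i $ j"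
      using assms by (intro mat_pow_mono_scaled) (auto simp: primitive_mat_def)
    finally show ?thesis .
  qed
  then show ?thesis using assms(2) k(1) by (auto simp: primitive_mat_def)
qed

lemma nonneg_tilted:
  assumes "\<And>i. nonneg_mat (A i)" "nonneg_mat B"
  shows "nonneg_mat (tilted_mat A B t)"
  using assms by (auto simp: nonneg_mat_def tilted_mat_def intro!: add_nonneg_nonneg sum_nonneg)

lemma primitive_tilted:
  fixes A :: "'l::finite \<Rightarrow> real ^ 'm::finite ^ 'm"
  assumes "\<And>i. nonneg_mat (A i)" "nonneg_mat B" "primitive_mat (total_mat A B)"
  shows "primitive_mat (tilted_mat A B t)"
proof (rule primitive_scaled[OF assms(3) nonneg_tilted[OF assms(1,2)]])
  \<comment> \<open>This factor lies below every exp (t_l) and also below 1, the coefficient of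
    B.\<close>
  show "0 < exp (- norm t)" by simp
  fix i j
  have "exp (- norm t) \<le> exp (t $ l)" for l
    using component_le_norm_cart[of t l] by (simp add: abs_le_iff)
  moreover have "exp (- norm t) * B $ i $ j \<le> 1 * B $ i $ j"
    using assms(2) by (intro mult_right_mono) (auto simp: nonneg_mat_def)
  ultimately show "exp (- norm t) * total_mat A B $ i $ j \<le> tilted_mat A B t $ i $ j"
    using assms(1)
    by (auto simp: total_mat_def tilted_mat_def distrib_left sum_distrib_left nonneg_mat_def
        intro!: add_mono sum_mono mult_right_mono)
qed

lemma tilted_zero [simp]: "tilted_mat A B 0 = total_mat A B"
  by (simp add: tilted_mat_def total_mat_def)

lemma has_partial_tilted:
  fixes A :: "'l::finite \<Rightarrow> real ^ 'm::finite ^ 'm"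
  shows "has_partial (tilted_mat A B) (exp (t $ j) *\<^sub>R A j) j t"
proof -
  have "has_partial (\<lambda>t. exp (t $ i) *\<^sub>R A i) (exp (t $ i) *\<^sub>R 0 + (exp (t $ i) * (if i = j then 1 else 0)) *\<^sub>R A i) j t" for i
    by (intro has_partial_scaleR has_partial_exp has_partial_nth has_partial_const)
  then have "has_partial (\<lambda>t. (\<Sum>i\<in>UNIV. exp (t $ i) *\<^sub>R A i) + B)
     ((\<Sum>i\<in>UNIV. exp (t $ i) *\<^sub>R 0 + (exp (t $ i) * (if i = j then 1 else 0)) *\<^sub>R A i) + 0) j t"
    by (intro has_partial_add has_partial_sum has_partial_const)
  moreover have "(\<Sum>i\<in>UNIV. exp (t $ i) *\<^sub>R 0 + (exp (t $ i) * (if i = j then 1 else 0)) *\<^sub>R A i) + 0 = exp (t $ j) *\<^sub>R A j"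
  proof -
    have "(\<Sum>i\<in>UNIV. (exp (t $ i) * (if i = j then 1 else 0)) *\<^sub>R A i) = (\<Sum>i\<in>UNIV. if i = j then exp (t $ j) *\<^sub>R A j else 0)"
      by (rule sum.cong) auto
    then show ?thesis by simp
  qed
  moreover have "tilted_mat A B = (\<lambda>t. (\<Sum>i\<in>UNIV. exp (t $ i) *\<^sub>R A i) + B)"
    by (simp add: fun_eq_iff tilted_mat_def)
  ultimately show ?thesis by simp
qed

text \<open>The derivative of D^n when D has derivative E, as a recurrence instead of a sum, so that
  bounds follow by induction.\<close>

primrec mat_pow_deriv :: "real ^ 'm::finite ^ 'm \<Rightarrow> real ^ 'm ^ 'm \<Rightarrow> nat \<Rightarrow> real ^ 'm ^ 'm" where
  "mat_pow_deriv D E 0 = 0"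
| "mat_pow_deriv D E (Suc n) = D ** mat_pow_deriv D E n + E ** mat_pow D n"

text \<open>E and F are first derivatives of D in two directions, and G is the derivative of E in
  the second one. The bracket collects the inhomogeneous term, as
  \<open>linear_recurrence_bound\<close> expects.\<close>

primrec mat_pow_deriv2 ::
    "real ^ 'm::finite ^ 'm \<Rightarrow> real ^ 'm ^ 'm \<Rightarrow> real ^ 'm ^ 'm \<Rightarrow> real ^ 'm ^ 'm \<Rightarrow> nat \<Rightarrow> real ^ 'm ^ 'm" where
  "mat_pow_deriv2 D E F G 0 = 0"
| "mat_pow_deriv2 D E F G (Suc n) =
     D ** mat_pow_deriv2 D E F G n
     + (F ** mat_pow_deriv D E n + (E ** mat_pow_deriv D F n + G ** mat_pow D n))"

lemma has_partial_mat_pow: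
  assumes "has_partial f d j t"
  shows "has_partial (\<lambda>t. mat_pow (f t) n) (mat_pow_deriv (f t) d n) j t"
proof (induction n)
  case (Suc n)
  show ?case using has_partial_matrix_mult[OF assms Suc] by simp
qed (simp add: has_partial_const)

lemma has_partial_mat_pow_deriv:
  assumes "has_partial f F i t" "has_partial g G i t"
  shows "has_partial (\<lambda>t. mat_pow_deriv (f t) (g t) n) (mat_pow_deriv2 (f t) (g t) F G n) i t"
proof (induction n)
  case (Suc n)
  show ?case
    using has_partial_add[OF has_partial_matrix_mult[OF assms(1) Suc]
        has_partial_matrix_mult[OF assms(2) has_partial_mat_pow[OF assms(1), of n]]]
    by (simp add: add_ac)
qed (simp add: has_partial_const)

text \<open>Only the powers of D are controlled, not the norm of D itself, so the induction bounds
  D^m Z(n) for all m at once; m = 0 gives the claim. The gap between \<rho> and \<sigma> absorbs the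
  factor n that summing the forcing terms could cost.\<close>

lemma linear_recurrence_bound:
  fixes D :: "real ^ 'm::finite ^ 'm" and F Z :: "nat \<Rightarrow> real ^ 'm ^ 'm"
  assumes D: "\<And>n. norm (mat_pow D n) \<le> C0 * \<rho> ^ n" and \<rho>: "0 < \<rho>" "\<rho> < \<sigma>"
    and F: "\<And>n. norm (F n) \<le> C1 * \<sigma> ^ n"
    and Z: "Z 0 = 0" "\<And>n. Z (Suc n) = D ** Z n + F n"
  shows "\<exists>C. \<forall>n. norm (Z n) \<le> C * \<sigma> ^ n"
proof -
  obtain K where K: "K > 0" "\<And>(a :: real ^ 'm ^ 'm) (b :: real ^ 'm ^ 'm). norm (a ** b) \<le> norm a * norm b * K"
    using matrix_mult.pos_bounded by metis
  have C0: "0 \<le> C0" using order_trans[OF norm_ge_zero D[of 0]] by simp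
  have C1: "0 \<le> C1" using order_trans[OF norm_ge_zero F[of 0]] by simp
  \<comment> \<open>L solves L \<rho> + C0 C1 K = L \<sigma>, which makes the induction step close
    exactly.\<close>
  define L where "L = C0 * C1 * K / (\<sigma> - \<rho>)"
  have L: "0 \<le> L" "L * \<rho> + C0 * C1 * K = L * \<sigma>"
    unfolding L_def using \<rho> C0 C1 K(1) by (simp_all add: field_simps)
  have "norm (mat_pow D m ** Z n) \<le> L * \<sigma> ^ n * \<rho> ^ m" for m n
  proof (induction n arbitrary: m)
    case 0
    then show ?case using Z(1) L \<rho> by simp
  next
    case (Suc n)
    have "mat_pow D m ** Z (Suc n) = mat_pow D (Suc m) ** Z n + mat_pow D m ** F n"
      unfolding Z(2) mat_pow_Suc_right by (simp add: matrix_mult.add_right matrix_mul_assoc)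
    then have "norm (mat_pow D m ** Z (Suc n)) \<le> norm (mat_pow D (Suc m) ** Z n) + norm (mat_pow D m ** F n)"
      by (metis norm_triangle_ineq)
    also have "\<dots> \<le> L * \<sigma> ^ n * \<rho> ^ Suc m + (C0 * \<rho> ^ m) * (C1 * \<sigma> ^ n) * K"
    proof (rule add_mono[OF Suc])
      have "norm (mat_pow D m ** F n) \<le> norm (mat_pow D m) * norm (F n) * K" by (rule K)
      also have "\<dots> \<le> (C0 * \<rho> ^ m) * (C1 * \<sigma> ^ n) * K"
        using D[of m] F[of n] K(1) C0 \<rho> by (intro mult_right_mono mult_mono) auto
      finally show "norm (mat_pow D m ** F n) \<le> (C0 * \<rho> ^ m) * (C1 * \<sigma> ^ n) * K" .
    qed
    also have "\<dots> = (L * \<rho> + C0 * C1 * K) * \<sigma> ^ n * \<rho> ^ m" by (simp add: algebra_simps)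
    also have "\<dots> = L * \<sigma> ^ Suc n * \<rho> ^ m" by (simp add: L(2))
    finally show ?case .
  qed
  from this[of 0] show ?thesis by (intro exI[of _ L]) simp
qed

lemma mult_power_bound:
  fixes E :: "real ^ 'm::finite ^ 'm" and X :: "nat \<Rightarrow> real ^ 'm ^ 'm"
  assumes "\<exists>C. \<forall>n. norm (X n) \<le> C * (\<sigma> :: real) ^ n"
  shows "\<exists>C. \<forall>n. norm (E ** X n) \<le> C * \<sigma> ^ n"
proof -
  obtain C where C: "\<And>n. norm (X n) \<le> C * \<sigma> ^ n" using assms by blast
  obtain K where K: "K > 0" "\<And>(a :: real ^ 'm ^ 'm) (b :: real ^ 'm ^ 'm). norm (a ** b) \<le> norm a * norm b * K"
    using matrix_mult.pos_bounded by metis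
  have "norm (E ** X n) \<le> (norm E * C * K) * \<sigma> ^ n" for n
    using order_trans[OF K(2)[of E "X n"] mult_right_mono[OF mult_left_mono[OF C[of n]]]] K(1)
    by (simp add: mult_ac)
  then show ?thesis by blast
qed

lemma add_power_bound:
  assumes "\<exists>C. \<forall>n. norm (X n) \<le> C * (\<sigma> :: real) ^ n" "\<exists>C. \<forall>n. norm (Y n) \<le> C * \<sigma> ^ n"
  shows "\<exists>C. \<forall>n. norm (X n + Y n) \<le> C * \<sigma> ^ n"
proof -
  obtain C C' where "\<And>n. norm (X n) \<le> C * \<sigma> ^ n" "\<And>n. norm (Y n) \<le> C' * \<sigma> ^ n" using assms by blast
  then have "norm (X n + Y n) \<le> (C + C') * \<sigma> ^ n" for n
    by (metis add_mono distrib_right norm_triangle_le)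
  then show ?thesis by blast
qed

lemma power_bound_mono:
  assumes "\<And>n. norm (X n) \<le> C * \<rho> ^ n" "0 < \<rho>" "\<rho> < (\<sigma> :: real)"
  shows "\<exists>C. \<forall>n. norm (X n) \<le> C * \<sigma> ^ n"
proof -
  have "0 \<le> C" using order_trans[OF norm_ge_zero assms(1)[of 0]] by simp
  then have "norm (X n) \<le> C * \<sigma> ^ n" for n
    using order_trans[OF assms(1)[of n] mult_left_mono[OF power_mono[of \<rho> \<sigma> n]]] assms(2,3) by simp
  then show ?thesis by blast
qed

lemma mat_pow_deriv_bound:
  assumes D: "\<And>n. norm (mat_pow D n) \<le> C * \<rho> ^ n" "0 < \<rho>" "\<rho> < \<sigma>"
  shows "\<exists>C. \<forall>n. norm (mat_pow_deriv D E n) \<le> C * \<sigma> ^ n"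
proof -
  obtain C2 where "\<And>n. norm (E ** mat_pow D n) \<le> C2 * \<sigma> ^ n"
    using mult_power_bound[OF power_bound_mono[OF D]] by blast
  from linear_recurrence_bound[OF D this] show ?thesis by simp
qed

text \<open>The forcing term contains first derivatives at rate \<sigma>; as the powers of D have
  the smaller rate \<rho>, the same \<sigma> serves again.\<close>

lemma mat_pow_deriv2_bound:
  assumes D: "\<And>n. norm (mat_pow D n) \<le> C * \<rho> ^ n" "0 < \<rho>" "\<rho> < \<sigma>"
  shows "\<exists>C. \<forall>n. norm (mat_pow_deriv2 D E F G n) \<le> C * \<sigma> ^ n"
proof -
  have "\<exists>C. \<forall>n. norm (F ** mat_pow_deriv D E n + (E ** mat_pow_deriv D F n + G ** mat_pow D n)) \<le> C * \<sigma> ^ n"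
    by (intro add_power_bound mult_power_bound mat_pow_deriv_bound[OF D] power_bound_mono[OF D])
  then obtain C2 where "\<And>n. norm (F ** mat_pow_deriv D E n + (E ** mat_pow_deriv D F n + G ** mat_pow D n)) \<le> C2 * \<sigma> ^ n"
    by blast
  from linear_recurrence_bound[OF D this] show ?thesis by simp
qed

section \<open>Matrix powers as sums over words\<close>

lemma lists_length_Suc: "{w :: 'a list. length w = Suc n} = (\<lambda>(x, w). x # w) ` (UNIV \<times> {w. length w = n})"
  by (auto simp: image_iff length_Suc_conv)

lemma finite_words: "finite {w :: 'a::finite list. length w = n}"
  using finite_lists_length_eq[of "UNIV :: 'a set" n] by simp

lemma mat_pow_total:
  fixes A :: "'l::finite \<Rightarrow> real ^ 'm::finite ^ 'm"
  shows "mat_pow (total_mat A B) n = (\<Sum>w | length w = n. word_mat A B w)"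
proof (induction n)
  case (Suc n)
  have "total_mat A B = (\<Sum>x\<in>UNIV. letter_mat A B x)"
    by (simp add: total_mat_def UNIV_option_conv sum.reindex add.commute)
  then have "mat_pow (total_mat A B) (Suc n) = (\<Sum>x\<in>UNIV. \<Sum>w | length w = n. letter_mat A B x ** word_mat A B w)"
    using Suc by (simp add: matrix_mult.sum_left matrix_mult.sum_right) (rule sum.swap)
  also have "\<dots> = (\<Sum>(x, w)\<in>UNIV \<times> {w. length w = n}. letter_mat A B x ** word_mat A B w)"
    by (simp add: sum.cartesian_product)
  also have "\<dots> = (\<Sum>w | length w = Suc n. word_mat A B w)"
    unfolding lists_length_Suc by (subst sum.reindex) (auto simp: inj_on_def intro!: sum.cong)
  finally show ?case .
qed simp

lemma word_mat_tilted:
  fixes A :: "'l::finite \<Rightarrow> real ^ 'm::finite ^ 'm"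
  shows "word_mat (\<lambda>i. exp (t $ i) *\<^sub>R A i) B w = exp (t \<bullet> symbol_counts w) *\<^sub>R word_mat A B w"
proof (induction w)
  case Nil
  then show ?case by (simp add: symbol_counts_def inner_vec_def)
next
  case (Cons x w)
  show ?case
  proof (cases x)
    case None
    then show ?thesis using Cons by (simp add: symbol_counts_def matrix_mult.scaleR_right)
  next
    case (Some i)
    have "symbol_counts (x # w) = axis i 1 + symbol_counts w"
      by (auto simp: Some symbol_counts_def axis_def vec_eq_iff)
    then have "t \<bullet> symbol_counts (x # w) = t $ i + t \<bullet> symbol_counts w"
      by (simp add: inner_add_right inner_axis)
    then show ?thesis using Cons Some
      by (simp add: matrix_mult.scaleR_right matrix_mult.scaleR_left exp_add)
  qed
qed

definition bilin :: "real ^ 'm::finite \<Rightarrow> real ^ 'm \<Rightarrow> real ^ 'm ^ 'm \<Rightarrow> real" where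
  "bilin \<xi> \<eta> X = \<xi> \<bullet> (X *v \<eta>)"

lemma bounded_linear_bilin: "bounded_linear (bilin \<xi> \<eta>)"
  unfolding bilin_def
  by (rule bounded_linear_compose[OF bounded_linear_inner_right matrix_vec.bounded_linear_left])

text \<open>Up to normalization this is the moment generating function of the counts; the right-hand
  side is a finite sum and can be differentiated term by term.\<close>

lemma bilin_mat_pow_tilted:
  fixes A :: "'l::finite \<Rightarrow> real ^ 'm::finite ^ 'm"
  shows "bilin \<xi> \<eta> (mat_pow (tilted_mat A B t) n)
    = (\<Sum>w | length w = n. exp (t \<bullet> symbol_counts w) * bilin \<xi> \<eta> (word_mat A B w))"
proof -
  have "tilted_mat A B t = total_mat (\<lambda>i. exp (t $ i) *\<^sub>R A i) B"
    by (simp add: tilted_mat_def total_mat_def)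
  then have "mat_pow (tilted_mat A B t) n = (\<Sum>w | length w = n. exp (t \<bullet> symbol_counts w) *\<^sub>R word_mat A B w)"
    by (simp add: mat_pow_total word_mat_tilted)
  then show ?thesis
    by (simp add: linear_sum[OF bounded_linear.linear[OF bounded_linear_bilin]]
        linear_simps(5)[OF bounded_linear_bilin])
qed

section \<open>Geometrically small errors\<close>

text \<open>The rate is existential, so errors with different rates combine freely; a common one is
  fixed only in \<open>uniform_geometric_bound\<close>.\<close>

definition geometrically_small :: "(nat \<Rightarrow> real) \<Rightarrow> bool" where
  "geometrically_small f \<longleftrightarrow> (\<exists>\<epsilon>. 0 < \<epsilon> \<and> \<epsilon> < 1 \<and> f \<in> O(\<lambda>n. \<epsilon> ^ n))"

text \<open>This class contains the polynomials in n and the geometrically small sequences, is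
  closed under products, and multiplication by its members preserves geometric smallness.\<close>

definition subexponential :: "(nat \<Rightarrow> real) \<Rightarrow> bool" where
  "subexponential f \<longleftrightarrow> (\<forall>\<delta>>1. f \<in> O(\<lambda>n. \<delta> ^ n))"

text \<open>The growth condition on \<open>g\<close> is there for products, where the error of one
  factor is multiplied by the main term of the other.\<close>

definition geometric_approx :: "(nat \<Rightarrow> real) \<Rightarrow> (nat \<Rightarrow> real) \<Rightarrow> bool" where
  "geometric_approx f g \<longleftrightarrow> subexponential g \<and> geometrically_small (\<lambda>n. f n - g n)"

lemma bigo_power_mono:
  assumes "f \<in> O(\<lambda>n. a ^ n)" "0 \<le> (a::real)" "a \<le> b"
  shows "f \<in> O(\<lambda>n. b ^ n)"
proof -
  have "norm (a ^ n) \<le> 1 * norm (b ^ n)" for n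
    using power_mono[OF assms(3,2), of n] assms(2,3) by simp
  then have "(\<lambda>n. a ^ n) \<in> O(\<lambda>n. b ^ n)" by (intro bigoI[of _ 1] always_eventually allI)
  then show ?thesis by (rule landau_o.big_trans[OF assms(1)])
qed

lemma geometrically_small_add:
  assumes "geometrically_small f" "geometrically_small g"
  shows "geometrically_small (\<lambda>n. f n + g n)"
proof -
  obtain a b where ab: "0 < a" "a < 1" "f \<in> O(\<lambda>n. a ^ n)" "0 < b" "b < 1" "g \<in> O(\<lambda>n. b ^ n)"
    using assms by (auto simp: geometrically_small_def)
  have "f \<in> O(\<lambda>n. max a b ^ n)" "g \<in> O(\<lambda>n. max a b ^ n)"
    by (rule bigo_power_mono[OF ab(3)] bigo_power_mono[OF ab(6)]; use ab in simp)+
  then have "(\<lambda>n. f n + g n) \<in> O(\<lambda>n. max a b ^ n)" by (rule sum_in_bigo)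
  then show ?thesis unfolding geometrically_small_def using ab by (intro exI[of _ "max a b"]) auto
qed

lemma geometrically_small_mult:
  assumes "geometrically_small f" "subexponential g"
  shows "geometrically_small (\<lambda>n. f n * g n)"
proof -
  obtain a where a: "0 < a" "a < 1" "f \<in> O(\<lambda>n. a ^ n)"
    using assms by (auto simp: geometrically_small_def)
  \<comment> \<open>A value strictly between 1 and 1 / a: the reciprocal of the mean of 1 and
    a.\<close>
  define d where "d = 2 / (1 + a)"
  have d: "1 < d" "a * d < 1" "0 < a * d" using a by (auto simp: d_def divide_simps)
  have "(\<lambda>n. f n * g n) \<in> O(\<lambda>n. a ^ n * d ^ n)"
    using a assms(2) d by (intro landau_o.big.mult) (auto simp: subexponential_def)
  then show ?thesis unfolding geometrically_small_def using d
    unfolding power_mult_distrib by (intro exI[of _ "a * d"]) (simp add: power_mult_distrib[abs_def])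
qed

lemma subexponential_mult:
  assumes "subexponential f" "subexponential g"
  shows "subexponential (\<lambda>n. f n * g n)"
  unfolding subexponential_def
proof (intro allI impI)
  fix d :: real assume d: "d > 1"
  have "(\<lambda>n. f n * g n) \<in> O(\<lambda>n. sqrt d ^ n * sqrt d ^ n)"
    using assms d by (intro landau_o.big.mult) (auto simp: subexponential_def)
  then show "(\<lambda>n. f n * g n) \<in> O(\<lambda>n. d ^ n)"
    using d by (simp add: power_mult_distrib[symmetric])
qed

lemma subexponential_add:
  "subexponential f \<Longrightarrow> subexponential g \<Longrightarrow> subexponential (\<lambda>n. f n + g n)"
  by (auto simp: subexponential_def intro!: sum_in_bigo)

lemma subexponential_const: "subexponential (\<lambda>_. c)"
  unfolding subexponential_def
proof (intro allI impI)
  fix d :: real assume "d > 1"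
  then show "(\<lambda>_. c) \<in> O(\<lambda>n. d ^ n)"
    by (intro bigoI[of _ "\<bar>c\<bar>"] always_eventually) (auto intro: mult_left_mono[of 1 _ "\<bar>c\<bar>", simplified])
qed

lemma subexponential_real: "subexponential (\<lambda>n. real n)"
  unfolding subexponential_def
proof (intro allI impI)
  fix d :: real assume "d > 1"
  then show "(\<lambda>n. real n) \<in> O(\<lambda>n. d ^ n)" by real_asymp
qed

lemma geometrically_small_subexponential:
  assumes "geometrically_small f"
  shows "subexponential f"
  unfolding subexponential_def
proof (intro allI impI)
  fix d :: real assume d: "d > 1"
  obtain a where a: "0 < a" "a < 1" "f \<in> O(\<lambda>n. a ^ n)"
    using assms by (auto simp: geometrically_small_def)
  show "f \<in> O(\<lambda>n. d ^ n)" by (rule bigo_power_mono[OF a(3)]) (use a d in simp_all)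
qed

lemma geometrically_small_tendsto:
  assumes "geometrically_small f"
  shows "f \<longlonglongrightarrow> 0"
proof -
  obtain a where a: "0 < a" "a < 1" "f \<in> O(\<lambda>n. a ^ n)"
    using assms by (auto simp: geometrically_small_def)
  from a(3) obtain c where "\<forall>\<^sub>F n in sequentially. norm (f n) \<le> c * norm (a ^ n)"
    by (elim landau_o.bigE)
  then have "\<forall>\<^sub>F n in sequentially. norm (f n) \<le> c * a ^ n" using a(1) by simp
  moreover have "(\<lambda>n. c * a ^ n) \<longlonglongrightarrow> 0"
    using a by (intro tendsto_mult_right_zero LIMSEQ_realpow_zero) auto
  ultimately show ?thesis by (rule Lim_null_comparison)
qed

lemma geometrically_small_uminus: "geometrically_small f \<Longrightarrow> geometrically_small (\<lambda>n. - f n)"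
  by (simp add: geometrically_small_def)

lemma geometrically_small_ev_cong:
  assumes "\<forall>\<^sub>F n in sequentially. f n = g n" "geometrically_small g"
  shows "geometrically_small f"
  using assms landau_o.big.in_cong[OF assms(1)] by (auto simp: geometrically_small_def)

lemma geometric_approx_mult:
  assumes "geometric_approx f f'" "geometric_approx g g'"
  shows "geometric_approx (\<lambda>n. f n * g n) (\<lambda>n. f' n * g' n)"
proof -
  have "f n * g n - f' n * g' n = (f n - f' n) * g' n + (g n - g' n) * f' n + (f n - f' n) * (g n - g' n)" for n
    by (simp add: algebra_simps)
  moreover have "geometrically_small (\<lambda>n. (f n - f' n) * g' n + (g n - g' n) * f' n + (f n - f' n) * (g n - g' n))"
    using assms unfolding geometric_approx_def
    by (intro geometrically_small_add geometrically_small_mult)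
      (simp_all add: geometrically_small_subexponential)
  ultimately show ?thesis using assms by (simp add: geometric_approx_def subexponential_mult)
qed

lemma geometric_approx_diff:
  assumes "geometric_approx f f'" "geometric_approx g g'"
  shows "geometric_approx (\<lambda>n. f n - g n) (\<lambda>n. f' n - g' n)"
proof -
  have "geometrically_small (\<lambda>n. (f n - f' n) + - (g n - g' n))"
    using assms unfolding geometric_approx_def
    by (intro geometrically_small_add geometrically_small_uminus) auto
  moreover have "subexponential (\<lambda>n. f' n + (-1) * g' n)"
    using assms by (intro subexponential_add subexponential_mult subexponential_const) (auto simp: geometric_approx_def)
  ultimately show ?thesis by (simp add: geometric_approx_def algebra_simps)
qed

text \<open>1 / f - 1 = - (f - 1) (1 / f), and 1 / f is eventually below 2. The identity may fail at
  finitely many n where f vanishes, hence the passage through eventual equality.\<close>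

lemma geometric_approx_inverse:
  assumes "geometric_approx f (\<lambda>_. 1)"
  shows "geometric_approx (\<lambda>n. 1 / f n) (\<lambda>_. 1)"
proof -
  have small: "geometrically_small (\<lambda>n. f n - 1)" using assms by (simp add: geometric_approx_def)
  from geometrically_small_tendsto[OF this] have lim: "f \<longlonglongrightarrow> 1" by (simp add: LIM_zero_iff)
  then have pos: "\<forall>\<^sub>F n in sequentially. 1 / 2 < f n" by (rule order_tendstoD) simp
  then have "(\<lambda>n. 1 / f n) \<in> O(\<lambda>_. 1)"
    by (intro bigoI[of _ 2]) (auto elim!: eventually_mono simp: divide_simps)
  then have "subexponential (\<lambda>n. 1 / f n)"
    using subexponential_const[of 1] unfolding subexponential_def by (blast intro: landau_o.big_trans)
  from geometrically_small_mult[OF small this]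
  have "geometrically_small (\<lambda>n. - ((f n - 1) * (1 / f n)))" by (rule geometrically_small_uminus)
  then have "geometrically_small (\<lambda>n. 1 / f n - 1)"
    by (rule geometrically_small_ev_cong[rotated])
       (use pos in \<open>auto elim!: eventually_mono simp: field_simps\<close>)
  then show ?thesis by (simp add: geometric_approx_def subexponential_const)
qed

lemma geometrically_small_quotient:
  fixes X :: "nat \<Rightarrow> 'a::real_normed_vector"
  assumes "bounded_linear L" "\<exists>C. \<forall>n. norm (X n) \<le> C * \<sigma> ^ n" "0 < \<sigma>" "\<sigma> < r"
  shows "geometrically_small (\<lambda>n. L (X n) / (r ^ n * c))"
proof -
  obtain C where C: "\<And>n. norm (X n) \<le> C * \<sigma> ^ n" using assms(2) by blast
  obtain K where K: "\<And>x. norm (L x) \<le> norm x * K" "0 < K" using bounded_linear.pos_bounded[OF assms(1)] by metis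
  have "norm (L (X n) / (r ^ n * c)) \<le> (C * K / \<bar>c\<bar>) * norm ((\<sigma> / r) ^ n)" for n
  proof -
    have "\<bar>L (X n)\<bar> \<le> C * \<sigma> ^ n * K"
      using order_trans[OF K(1)[of "X n"] mult_right_mono[OF C[of n]]] K(2) by simp
    then have "\<bar>L (X n)\<bar> / (r ^ n * \<bar>c\<bar>) \<le> C * \<sigma> ^ n * K / (r ^ n * \<bar>c\<bar>)"
      using assms(3,4) by (intro divide_right_mono) auto
    then show ?thesis using assms(3,4) by (simp add: abs_mult power_divide mult_ac)
  qed
  then have "(\<lambda>n. L (X n) / (r ^ n * c)) \<in> O(\<lambda>n. (\<sigma> / r) ^ n)"
    by (intro bigoI[of _ "C * K / \<bar>c\<bar>"] always_eventually allI)
  then show ?thesis unfolding geometrically_small_def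
    using assms(3,4) by (intro exI[of _ "\<sigma> / r"]) auto
qed

section \<open>Moments of the symbol statistics\<close>

text \<open>E(XY) - E(X) E(Y) with the normalization pulled out as \<open>Z\<close>, so that
  derivatives of the generating sum can be inserted directly.\<close>

lemma cov_matrix_word_measure:
  fixes A :: "'l::finite \<Rightarrow> real ^ 'm::finite ^ 'm"
  assumes nonneg: "\<And>w. 0 \<le> bilin \<xi> \<eta> (word_mat A B w)"
    and Z: "Z = (\<Sum>w | length w = n. bilin \<xi> \<eta> (word_mat A B w))" "0 < Z"
  shows "cov_matrix (word_measure \<xi> A B \<eta> n) symbol_counts $ i $ j =
    (\<Sum>w | length w = n. bilin \<xi> \<eta> (word_mat A B w) * symbol_counts w $ i * symbol_counts w $ j) / Z
    - (\<Sum>w | length w = n. bilin \<xi> \<eta> (word_mat A B w) * symbol_counts w $ i) / Z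
      * ((\<Sum>w | length w = n. bilin \<xi> \<eta> (word_mat A B w) * symbol_counts w $ j) / Z)"
proof -
  let ?W = "{w :: 'l option list. length w = n}"
  let ?q = "\<lambda>w. bilin \<xi> \<eta> (word_mat A B w) / Z"
  let ?c = "\<lambda>i w. symbol_counts w $ i"
  have "Z = bilin \<xi> \<eta> (mat_pow (total_mat A B) n)"
    using bilin_mat_pow_tilted[of \<xi> \<eta> A B 0 n] by (simp add: Z(1))
  then have wm: "word_measure \<xi> A B \<eta> n = point_measure ?W (\<lambda>w. ennreal (?q w))"
    by (simp add: word_measure_def bilin_def)
  have int: "integral\<^sup>L (word_measure \<xi> A B \<eta> n) g = (\<Sum>w\<in>?W. ?q w * g w)" for g :: "'l option list \<Rightarrow> real"
    unfolding wm using nonneg Z(2) by (subst lebesgue_integral_point_measure_finite) (auto simp: finite_words)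
  define E where "E i = (\<Sum>w\<in>?W. ?q w * ?c i w)" for i
  have one: "(\<Sum>w\<in>?W. ?q w) = 1"
    using Z by (simp add: sum_divide_distrib[symmetric])
  have "cov_matrix (word_measure \<xi> A B \<eta> n) symbol_counts $ i $ j
      = (\<Sum>w\<in>?W. ?q w * ((?c i w - E i) * (?c j w - E j)))"
    by (simp add: cov_matrix_def int E_def)
  also have "\<dots> = (\<Sum>w\<in>?W. ?q w * ?c i w * ?c j w - E j * (?q w * ?c i w) - E i * (?q w * ?c j w) + E i * E j * ?q w)"
    by (rule sum.cong) (simp_all add: algebra_simps)
  also have "\<dots> = (\<Sum>w\<in>?W. ?q w * ?c i w * ?c j w) - E j * E i - E i * E j + E i * E j * (\<Sum>w\<in>?W. ?q w)"
    by (simp only: sum.distrib sum_subtractf sum_distrib_left[symmetric] E_def[symmetric])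
  also have "\<dots> = (\<Sum>w\<in>?W. ?q w * ?c i w * ?c j w) - E i * E j" by (simp add: one)
  finally show ?thesis by (simp add: E_def sum_divide_distrib)
qed

locale symbol_statistics =
  fixes A :: "'l::finite \<Rightarrow> real ^ 'm::finite ^ 'm" and B :: "real ^ 'm ^ 'm"
  assumes nonneg_A: "\<And>i. nonneg_mat (A i)" and nonneg_B: "nonneg_mat B"
    and primitive_total: "primitive_mat (total_mat A B)"
begin

abbreviation "M \<equiv> tilted_mat A B"
abbreviation "y \<equiv> y_fun A B"
abbreviation "P t \<equiv> pf_proj (M t)"

text \<open>\<open>M1\<close>, \<open>y1\<close>, \<open>P1\<close> and \<open>D1\<close> are the
  first partial derivatives in direction j, as explicit functions of t so that they can be
  differentiated once more.\<close>

definition "M1 j t = exp (t $ j) *\<^sub>R A j"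
text \<open>Equals v' M1 u, the classical first-order formula for a simple eigenvalue.\<close>

definition "y1 j t = trace (P t ** M1 j t ** P t)"
definition "P1 j t = pf_resolvent (M t) ** (M1 j t - y1 j t *\<^sub>R mat 1) ** P t
  + P t ** (M1 j t - y1 j t *\<^sub>R mat 1) ** pf_resolvent (M t)"
definition "D t = M t - y t *\<^sub>R P t"
definition "D1 j t = M1 j t - (y t *\<^sub>R P1 j t + y1 j t *\<^sub>R P t)"

lemma primitive_M: "primitive_mat (M t)"
  using primitive_tilted nonneg_A nonneg_B primitive_total by blast

lemma y_pos: "0 < y t"
  using pf_eigenvalue_pos[OF primitive_M] by (simp add: y_fun_def)

lemma has_partial_M: "has_partial M (M1 j t) j t"
  unfolding M1_def by (rule has_partial_tilted)

lemma has_partial_y: "has_partial y (y1 j t) j t"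
  using has_partial_pf_eigenvalue[of M, OF primitive_M has_partial_M[of j t]]
  by (simp add: y1_def y_fun_def[abs_def])

lemma has_partial_P: "has_partial (\<lambda>t. P t) (P1 j t) j t"
  using has_partial_pf_proj[of M, OF primitive_M has_partial_M[of j t]] by (simp add: P1_def y1_def)

lemma has_partial_D: "has_partial D (D1 j t) j t"
  unfolding D_def[abs_def] D1_def
  by (intro has_partial_diff has_partial_M has_partial_scaleR has_partial_y has_partial_P)

lemma partially_differentiable_M1: "partially_differentiable (M1 j) i t"
  unfolding partially_differentiable_def M1_def[abs_def]
  using has_partial_scaleR[OF has_partial_exp[OF has_partial_nth] has_partial_const] by blast

lemma partially_differentiable_P: "partially_differentiable (\<lambda>t. P t) i t"
  unfolding partially_differentiable_def using has_partial_P by blast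

lemma partially_differentiable_y1: "partially_differentiable (y1 j) i t"
  unfolding y1_def[abs_def]
  by (intro partially_differentiable_trace partially_differentiable_matrix_mult
      partially_differentiable_M1 partially_differentiable_P)

lemma partially_differentiable_P1: "partially_differentiable (P1 j) i t"
  unfolding P1_def[abs_def]
  by (intro partially_differentiable_add partially_differentiable_matrix_mult partially_differentiable_diff
      partially_differentiable_scaleR partially_differentiable_M1 partially_differentiable_P
      partially_differentiable_y1 partially_differentiable_const
      partially_differentiable_pf_resolvent[OF primitive_M has_partial_M])

lemma partially_differentiable_D1: "partially_differentiable (D1 j) i t"
proof -
  have "partially_differentiable y i t" unfolding partially_differentiable_def using has_partial_y by blast
  then show ?thesis
    unfolding D1_def[abs_def]
    by (intro partially_differentiable_add partially_differentiable_diff partially_differentiable_scaleR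
        partially_differentiable_M1 partially_differentiable_P partially_differentiable_y1 partially_differentiable_P1)
qed

lemma partial_deriv_y: "partial_deriv j y = y1 j"
  using has_partial_partial_deriv[OF has_partial_y] by (simp add: fun_eq_iff)

lemma gamma_mat_eq:
  "gamma_mat A B $ i $ j =
    1 / y 0 * partial_deriv i (partial_deriv j y) 0 - 1 / (y 0)\<^sup>2 * partial_deriv i y 0 * partial_deriv j y 0"
proof -
  obtain y2 where y2: "has_partial (y1 j) y2 i 0"
    using partially_differentiable_y1 unfolding partially_differentiable_def by blast
  have "partial_deriv j (\<lambda>t. ln (y t)) = (\<lambda>t. y1 j t / y t)"
    using has_partial_partial_deriv[OF has_partial_ln[OF has_partial_y y_pos]] by (simp add: fun_eq_iff)
  moreover have "has_partial (\<lambda>t. y1 j t / y t) ((y2 * y 0 - y1 j 0 * y1 i 0) / (y 0 * y 0)) i 0"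
    using y_pos[of 0] by (intro has_partial_divide y2 has_partial_y) simp
  ultimately have "gamma_mat A B $ i $ j = (y2 * y 0 - y1 j 0 * y1 i 0) / (y 0 * y 0)"
    by (simp add: gamma_mat_def has_partial_partial_deriv)
  then show ?thesis
    using y_pos[of 0] by (simp add: partial_deriv_y has_partial_partial_deriv[OF y2] field_simps power2_eq_square)
qed

text \<open>Since \<xi>'u v'\<eta> = \<xi>'P\<eta>, the function r is a linear functional of P and
  inherits its derivatives.\<close>

lemma r_fun_eq: "r_fun \<xi> A B \<eta> t = bilin \<xi> \<eta> (P t) / bilin \<xi> \<eta> (P 0)"
  by (simp add: r_fun_def pf_proj_def bilin_def outer_mult_vec mult.commute)

lemma D_power_bound: "\<exists>\<rho> C. 0 < \<rho> \<and> \<rho> < y t \<and> (\<forall>n. norm (mat_pow (D t) n) \<le> C * \<rho> ^ n)"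
  using perron.deflated_power_bound[OF perron_pf[OF primitive_M[of t]]]
  by (simp add: D_def y_fun_def pf_proj_def)

lemma mat_pow_M:
  assumes "n \<ge> 1"
  shows "mat_pow (M t) n = y t ^ n *\<^sub>R P t + mat_pow (D t) n"
proof -
  obtain m where "n = Suc m" using assms by (cases n) auto
  then show ?thesis
    using perron.mat_pow_spectral[OF perron_pf[OF primitive_M[of t]], of m]
    by (simp add: D_def y_fun_def pf_proj_def)
qed

context
  fixes \<xi> \<eta> :: "real ^ 'm" and wt :: "'l option list \<Rightarrow> real"
  defines "wt \<equiv> \<lambda>w. bilin \<xi> \<eta> (word_mat A B w)"
begin

abbreviation "L \<equiv> bilin \<xi> \<eta>"

lemma L_add: "L (X + Y) = L X + L Y" and L_scaleR: "L (c *\<^sub>R X) = c * L X"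
  by (simp_all add: linear_simps[OF bounded_linear_bilin])

text \<open>The coefficients \<open>c\<close> are arbitrary so that the rule can be iterated: each
  differentiation multiplies the coefficient of a word by a count.\<close>

lemma has_partial_generating:
  fixes j :: 'l
  shows "has_partial (\<lambda>t. \<Sum>w | length w = n. exp (t \<bullet> symbol_counts w) * c w)
    (\<Sum>w | length w = n. exp (t \<bullet> symbol_counts w) * (symbol_counts w $ j * c w)) j t"
proof (rule has_partial_sum)
  fix w :: "'l option list"
  have "has_partial (\<lambda>t. t \<bullet> symbol_counts w) (symbol_counts w $ j) j t"
    unfolding has_partial_def has_real_derivative_iff_has_vector_derivative[symmetric] inner_add_left
    by (auto intro!: derivative_eq_intros simp: inner_axis')
  from has_partial_bilinear[OF bounded_bilinear_mult has_partial_exp[OF this] has_partial_const[of "c w"]]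
  show "has_partial (\<lambda>t. exp (t \<bullet> symbol_counts w) * c w) (exp (t \<bullet> symbol_counts w) * (symbol_counts w $ j * c w)) j t"
    by (simp add: mult.assoc)
qed

lemma zeroth_moment:
  assumes "n \<ge> 1"
  shows "(\<Sum>w | length w = n. wt w) = y 0 ^ n * L (P 0) + L (mat_pow (D 0) n)"
  using bilin_mat_pow_tilted[of \<xi> \<eta> A B 0 n] mat_pow_M[OF assms, of 0]
  by (simp add: wt_def L_add L_scaleR)

text \<open>Both sides are the partial derivative of \<xi>'M(t)^n\<eta>, computed from the sum over
  words and from the spectral decomposition. The identity is kept for all t because it is
  differentiated again.\<close>

lemma first_moment_tilted:
  assumes n: "n \<ge> 1"
  shows "(\<Sum>w | length w = n. exp (t \<bullet> symbol_counts w) * (symbol_counts w $ j * wt w)) =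
    y t ^ n * L (P1 j t) + real n * y t ^ (n - 1) * y1 j t * L (P t) + L (mat_pow_deriv (D t) (D1 j t) n)"
proof (rule has_partial_unique)
  show "has_partial (\<lambda>t. \<Sum>w | length w = n. exp (t \<bullet> symbol_counts w) * wt w)
    (\<Sum>w | length w = n. exp (t \<bullet> symbol_counts w) * (symbol_counts w $ j * wt w)) j t"
    by (rule has_partial_generating)
  have "has_partial (\<lambda>t. y t ^ n * L (P t) + L (mat_pow (D t) n))
    (y t ^ n * L (P1 j t) + real n * y t ^ (n - 1) * y1 j t * L (P t) + L (mat_pow_deriv (D t) (D1 j t) n)) j t"
    by (intro has_partial_add has_partial_bilinear[OF bounded_bilinear_mult] has_partial_power has_partial_y
        has_partial_linear[OF bounded_linear_bilin] has_partial_P has_partial_mat_pow has_partial_D)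
  moreover have "(\<lambda>t. y t ^ n * L (P t) + L (mat_pow (D t) n)) = (\<lambda>t. \<Sum>w | length w = n. exp (t \<bullet> symbol_counts w) * wt w)"
    using bilin_mat_pow_tilted[of \<xi> \<eta> A B _ n] mat_pow_M[OF n]
    by (simp add: wt_def L_add L_scaleR fun_eq_iff)
  ultimately show "has_partial (\<lambda>t. \<Sum>w | length w = n. exp (t \<bullet> symbol_counts w) * wt w)
    (y t ^ n * L (P1 j t) + real n * y t ^ (n - 1) * y1 j t * L (P t) + L (mat_pow_deriv (D t) (D1 j t) n)) j t"
    by simp
qed

lemma first_moment:
  assumes n: "n \<ge> 1"
  shows "(\<Sum>w | length w = n. wt w * symbol_counts w $ j) =
    y 0 ^ n * L (P1 j 0) + real n * y 0 ^ (n - 1) * y1 j 0 * L (P 0) + L (mat_pow_deriv (D 0) (D1 j 0) n)"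
  using first_moment_tilted[OF n, where t = 0] by (simp add: mult.commute)

text \<open>The right-hand side keeps the shape that the product rule produces from
  \<open>first_moment_tilted\<close>.\<close>

lemma second_moment:
  assumes n: "n \<ge> 1" and y2: "has_partial (y1 j) y2 i 0" and P2: "has_partial (P1 j) P2 i 0"
    and D2: "has_partial (D1 j) D2 i 0"
  shows "(\<Sum>w | length w = n. wt w * symbol_counts w $ i * symbol_counts w $ j) =
    y 0 ^ n * L P2 + real n * y 0 ^ (n - 1) * y1 i 0 * L (P1 j 0)
    + (real n * y 0 ^ (n - 1) * y1 j 0 * L (P1 i 0)
       + (real n * y 0 ^ (n - 1) * y2 + real n * (real (n - 1) * y 0 ^ (n - 1 - 1) * y1 i 0) * y1 j 0) * L (P 0))
    + L (mat_pow_deriv2 (D 0) (D1 j 0) (D1 i 0) D2 n)" (is "?lhs = ?rhs")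
proof -
  let ?S = "\<lambda>t. \<Sum>w | length w = n. exp (t \<bullet> symbol_counts w) * (symbol_counts w $ j * wt w)"
  have "has_partial (\<lambda>t. real n * y t ^ (n - 1)) (real n * (real (n - 1) * y 0 ^ (n - 1 - 1) * y1 i 0)) i 0"
    by (rule has_partial_linear[OF bounded_linear_mult_right]) (intro has_partial_power has_partial_y)
  then have "has_partial (\<lambda>t. y t ^ n * L (P1 j t) + real n * y t ^ (n - 1) * y1 j t * L (P t) + L (mat_pow_deriv (D t) (D1 j t) n)) ?rhs i 0"
    by (intro has_partial_add has_partial_bilinear[OF bounded_bilinear_mult] has_partial_power has_partial_y
        has_partial_linear[OF bounded_linear_bilin] has_partial_P has_partial_mat_pow_deriv has_partial_D y2 P2 D2)
  then have "has_partial ?S ?rhs i 0" by (simp only: first_moment_tilted[OF n])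
  moreover have "has_partial ?S (\<Sum>w | length w = n. exp (0 \<bullet> symbol_counts w) * (symbol_counts w $ i * (symbol_counts w $ j * wt w))) i 0"
    by (rule has_partial_generating)
  ultimately have "?rhs = (\<Sum>w | length w = n. exp (0 \<bullet> symbol_counts w) * (symbol_counts w $ i * (symbol_counts w $ j * wt w)))"
    by (rule has_partial_unique)
  then show ?thesis by (simp add: mult_ac)
qed

text \<open>Divided by \<lambda>^n \<xi>'P(0)\<eta>, the raw moments of order 0, 1 and 2 become
  \<open>h\<close>, \<open>m1\<close> and \<open>m2\<close>, which are constant, linear and
  quadratic in n up to geometric errors. The covariance is a difference of products of their
  quotients by \<open>h\<close>, to which the approximation rules apply.\<close>

lemma covariance_entry:
  assumes nonneg: "\<And>w. 0 \<le> wt w" and p0: "0 < L (P 0)"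
  shows "geometrically_small (\<lambda>n. (cov_matrix (word_measure \<xi> A B \<eta> n) symbol_counts
    - (real n *\<^sub>R gamma_mat A B + c_mat \<xi> A B \<eta>)) $ i $ j)"
proof -
  obtain y2 where y2: "has_partial (y1 j) y2 i 0"
    using partially_differentiable_y1 unfolding partially_differentiable_def by blast
  obtain P2 where P2: "has_partial (P1 j) P2 i 0"
    using partially_differentiable_P1 unfolding partially_differentiable_def by blast
  obtain D2 where D2: "has_partial (D1 j) D2 i 0"
    using partially_differentiable_D1 unfolding partially_differentiable_def by blast
  let ?l = "y 0" and ?p = "L (P 0)"
  have l: "0 < ?l" by (rule y_pos)
  obtain \<rho> C where \<rho>: "0 < \<rho>" "\<rho> < ?l" and D: "\<And>n. norm (mat_pow (D 0) n) \<le> C * \<rho> ^ n"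
    using D_power_bound by blast
  \<comment> \<open>Halfway between the rate of D(0)^n and \<lambda>: room for the loss incurred by
    differentiating the powers.\<close>
  define \<sigma> where "\<sigma> = (\<rho> + ?l) / 2"
  have \<sigma>: "\<rho> < \<sigma>" "0 < \<sigma>" "\<sigma> < ?l" using \<rho> by (auto simp: \<sigma>_def)
  note small = geometrically_small_quotient[OF bounded_linear_bilin _ \<sigma>(2,3), where c = ?p]
  define e0 where "e0 n = L (mat_pow (D 0) n) / (?l ^ n * ?p)" for n
  define e1 where "e1 j n = L (mat_pow_deriv (D 0) (D1 j 0) n) / (?l ^ n * ?p)" for j n
  define e2 where "e2 n = L (mat_pow_deriv2 (D 0) (D1 j 0) (D1 i 0) D2 n) / (?l ^ n * ?p)" for n
  have e: "geometrically_small e0" "\<And>j. geometrically_small (e1 j)" "geometrically_small e2"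
    unfolding e0_def[abs_def] e1_def[abs_def] e2_def[abs_def]
    by (intro small power_bound_mono[OF D \<rho>(1) \<sigma>(1)] mat_pow_deriv_bound[OF D \<rho>(1) \<sigma>(1)]
        mat_pow_deriv2_bound[OF D \<rho>(1) \<sigma>(1)])+
  \<comment> \<open>At 0, \<open>a\<close> and \<open>r\<close> hold the first derivatives of log y
    and of r, \<open>b\<close> is the second derivative of y divided by \<lambda>, and
    \<open>r2\<close> is the second derivative of r.\<close>
  define a where "a j = y1 j 0 / ?l" for j
  define r where "r j = L (P1 j 0) / ?p" for j
  define b where "b = y2 / ?l"
  define r2 where "r2 = L P2 / ?p"
  define h where "h n = 1 + e0 n" for n
  define m1 where "m1 j n = real n * a j + r j + e1 j n" for j n
  \<comment> \<open>The first term and \<open>b\<close> come from differentiating y^n twice, the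
    cross terms from one derivative on y^n and one on P, and \<open>r2\<close> from two on
    P.\<close>
  define m2' where "m2' n = real n * (real n - 1) * (a i * a j) + real n * (b + a j * r i + a i * r j) + r2" for n
  define m2 where "m2 n = m2' n + e2 n" for n
  have subexp: "subexponential (\<lambda>n. real n * c + d)" for c d
    by (intro subexponential_add subexponential_mult subexponential_real subexponential_const)
  have "subexponential (\<lambda>n. real n * (real n * 1 + (-1)) * (a i * a j) + real n * (b + a j * r i + a i * r j) + r2)"
    by (intro subexponential_add subexponential_mult subexponential_real subexponential_const subexp)
  then have "subexponential m2'" by (simp add: m2'_def[abs_def])
  then have approx2: "geometric_approx m2 m2'"
    using e(3) by (simp add: geometric_approx_def m2_def)
  have approx1: "geometric_approx (m1 j) (\<lambda>n. real n * a j + r j)" for j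
    using subexp e(2) by (simp add: geometric_approx_def m1_def)
  have "geometric_approx h (\<lambda>_. 1)"
    using subexponential_const e(1) by (simp add: geometric_approx_def h_def)
  then have "geometric_approx (\<lambda>n. 1 / h n) (\<lambda>_. 1)" by (rule geometric_approx_inverse)
  then have "geometric_approx (\<lambda>n. m2 n * (1 / h n) - m1 i n * (1 / h n) * (m1 j n * (1 / h n)))
      (\<lambda>n. m2' n * 1 - (real n * a i + r i) * 1 * ((real n * a j + r j) * 1))"
    by (intro geometric_approx_diff geometric_approx_mult approx1 approx2)
  then have small: "geometrically_small (\<lambda>n. m2 n / h n - m1 i n / h n * (m1 j n / h n)
      - (m2' n - (real n * a i + r i) * (real n * a j + r j)))"
    by (simp add: geometric_approx_def)
  have gamma: "gamma_mat A B $ i $ j = b - a i * a j"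
    unfolding gamma_mat_eq
    by (simp add: partial_deriv_y has_partial_partial_deriv[OF y2] a_def b_def power2_eq_square)
  have r_partial: "has_partial (r_fun \<xi> A B \<eta>) (L (P1 j t) / ?p) j t" for j t
    unfolding r_fun_eq[abs_def]
    by (intro has_partial_linear[OF bounded_linear_divide] has_partial_linear[OF bounded_linear_bilin] has_partial_P)
  have "has_partial (\<lambda>t. L (P1 j t) / ?p) r2 i 0"
    unfolding r2_def
    by (intro has_partial_linear[OF bounded_linear_divide] has_partial_linear[OF bounded_linear_bilin] P2)
  moreover have "partial_deriv j (r_fun \<xi> A B \<eta>) = (\<lambda>t. L (P1 j t) / ?p)" for j
    using has_partial_partial_deriv[OF r_partial] by (simp add: fun_eq_iff)
  ultimately have c: "c_mat \<xi> A B \<eta> $ i $ j = r2 - r i * r j"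
    by (simp add: c_mat_def has_partial_partial_deriv r_def)
  \<comment> \<open>The quadratic terms and the cross terms a_i r_j + a_j r_i cancel; the -n left
    over from n (n - 1) supplies - a_i a_j in \<Gamma>.\<close>
  have main: "m2' n - (real n * a i + r i) * (real n * a j + r j) = real n * (b - a i * a j) + (r2 - r i * r j)" for n
    by (simp add: m2'_def algebra_simps)
  have "h \<longlonglongrightarrow> 1 + 0" unfolding h_def by (intro tendsto_add tendsto_const geometrically_small_tendsto e)
  then have "\<forall>\<^sub>F n in sequentially. 0 < h n" by (rule order_tendstoD) simp
  \<comment> \<open>From n = 2 on, the truncated subtractions in the exponents n - 1 and n - 1 - 1
    are genuine.\<close>
  moreover have "\<forall>\<^sub>F n in sequentially. n \<ge> (2::nat)" by (rule eventually_ge_at_top)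
  ultimately have "\<forall>\<^sub>F n in sequentially. (cov_matrix (word_measure \<xi> A B \<eta> n) symbol_counts
      - (real n *\<^sub>R gamma_mat A B + c_mat \<xi> A B \<eta>)) $ i $ j
    = m2 n / h n - m1 i n / h n * (m1 j n / h n)
      - (m2' n - (real n * a i + r i) * (real n * a j + r j))"
  proof eventually_elim
    case (elim n)
    let ?s = "?l ^ n * ?p"
    obtain k where k: "n = Suc (Suc k)" using elim(2) by (metis Suc_le_D numeral_2_eq_2 Suc_le_mono)
    have s: "0 < ?s" using l p0 by simp
    have S0: "(\<Sum>w | length w = n. wt w) = ?s * h n"
      using elim(2) l p0 by (simp add: zeroth_moment h_def e0_def distrib_left)
    have S1: "(\<Sum>w | length w = n. wt w * symbol_counts w $ j) = ?s * m1 j n" for j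
    proof -
      have "?s * m1 j n = ?s * (real n * (y1 j 0 / ?l)) + ?s * (L (P1 j 0) / ?p)
          + ?s * (L (mat_pow_deriv (D 0) (D1 j 0) n) / ?s)"
        by (simp only: m1_def a_def r_def e1_def distrib_left)
      also have "?s * (L (mat_pow_deriv (D 0) (D1 j 0) n) / ?s) = L (mat_pow_deriv (D 0) (D1 j 0) n)"
        using s by (metis nonzero_mult_div_cancel_left times_divide_eq_right less_irrefl)
      also have "?s * (L (P1 j 0) / ?p) = ?l ^ n * L (P1 j 0)" using p0 by simp
      also have "?s * (real n * (y1 j 0 / ?l)) = real n * ?l ^ (n - 1) * y1 j 0 * ?p"
        using l by (simp add: k)
      finally show ?thesis using elim(2) by (simp add: first_moment)
    qed
    have S2: "(\<Sum>w | length w = n. wt w * symbol_counts w $ i * symbol_counts w $ j) = ?s * m2 n"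
    proof -
      have "?s * m2 n = ?s * (real n * (real n - 1) * (y1 i 0 / ?l * (y1 j 0 / ?l))) + ?s * (real n * (y2 / ?l))
          + ?s * (real n * (y1 j 0 / ?l * (L (P1 i 0) / ?p))) + ?s * (real n * (y1 i 0 / ?l * (L (P1 j 0) / ?p)))
          + ?s * (L P2 / ?p) + ?s * (L (mat_pow_deriv2 (D 0) (D1 j 0) (D1 i 0) D2 n) / ?s)"
        by (simp only: m2_def m2'_def a_def b_def r_def r2_def e2_def distrib_left add.assoc)
      also have "?s * (L (mat_pow_deriv2 (D 0) (D1 j 0) (D1 i 0) D2 n) / ?s) = L (mat_pow_deriv2 (D 0) (D1 j 0) (D1 i 0) D2 n)"
        using s by (metis nonzero_mult_div_cancel_left times_divide_eq_right less_irrefl)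
      also have "?s * (L P2 / ?p) = ?l ^ n * L P2" using p0 by simp
      also have "?s * (real n * (y1 j 0 / ?l * (L (P1 i 0) / ?p))) = real n * ?l ^ (n - 1) * y1 j 0 * L (P1 i 0)"
        using l p0 by (simp add: k)
      also have "?s * (real n * (y1 i 0 / ?l * (L (P1 j 0) / ?p))) = real n * ?l ^ (n - 1) * y1 i 0 * L (P1 j 0)"
        using l p0 by (simp add: k)
      also have "?s * (real n * (y2 / ?l)) = real n * ?l ^ (n - 1) * y2 * ?p"
        using l by (simp add: k)
      also have "?s * (real n * (real n - 1) * (y1 i 0 / ?l * (y1 j 0 / ?l)))
          = real n * (real (n - 1) * ?l ^ (n - 1 - 1) * y1 i 0) * y1 j 0 * ?p"
        using l by (simp add: k)
      finally show ?thesis using elim(2) by (simp add: second_moment[OF _ y2 P2 D2] distrib_right)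
    qed
    have "cov_matrix (word_measure \<xi> A B \<eta> n) symbol_counts $ i $ j
      = ?s * m2 n / (?s * h n) - ?s * m1 i n / (?s * h n) * (?s * m1 j n / (?s * h n))"
      using cov_matrix_word_measure[of \<xi> \<eta> A B "?s * h n" n i j] nonneg S0 S1 S2 s elim(1)
      by (simp add: wt_def)
    then have "cov_matrix (word_measure \<xi> A B \<eta> n) symbol_counts $ i $ j
      = m2 n / h n - m1 i n / h n * (m1 j n / h n)"
      using l p0 by simp
    then show ?case by (simp add: gamma c main)
  qed
  then show ?thesis using small by (rule geometrically_small_ev_cong)
qed

end

end

section \<open>Positivity of the weights and conclusion\<close>

lemma word_mat_nonneg:
  assumes "\<And>i. nonneg_mat (A i)" "nonneg_mat B"
  shows "nonneg_mat (word_mat A B w)"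
proof (induction w)
  case Nil
  then show ?case by (simp add: nonneg_mat_def mat_def)
next
  case (Cons x w)
  have "nonneg_mat (letter_mat A B x)" using assms by (cases x) auto
  then show ?case using Cons by (auto simp: nonneg_mat_def matrix_matrix_mult_def intro!: sum_nonneg)
qed

lemma bilin_nonneg:
  assumes "nonneg_vec \<xi>" "nonneg_vec \<eta>" "nonneg_mat X"
  shows "0 \<le> bilin \<xi> \<eta> X"
  using assms
  by (auto simp: bilin_def inner_vec_def matrix_vector_mult_def nonneg_vec_def nonneg_mat_def intro!: sum_nonneg mult_nonneg_nonneg)

lemma inner_pos_of_nonneg:
  fixes x z :: "real ^ 'm::finite"
  assumes "nonneg_vec x" "x \<noteq> 0" "\<And>i. 0 < z $ i"
  shows "0 < x \<bullet> z"
proof -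
  obtain i where "0 < x $ i" using assms(1,2) by (auto simp: vec_eq_iff nonneg_vec_def less_eq_real_def)
  then show ?thesis unfolding inner_vec_def using assms(1,3)
    by (intro sum_pos2[of _ i]) (auto simp: nonneg_vec_def less_imp_le)
qed

text \<open>There are finitely many index pairs, so the largest of their rates is still below 1 and
  serves for all.\<close>

lemma uniform_geometric_bound:
  assumes "\<And>i j. geometrically_small (f i j)"
  shows "\<exists>\<epsilon>::real. 0 < \<epsilon> \<and> \<epsilon> < 1 \<and> (\<forall>(i :: 'a::finite) (j :: 'b::finite). f i j \<in> O(\<lambda>n. \<epsilon> ^ n))"
proof -
  obtain e where e: "\<And>i j. 0 < e i j" "\<And>i j. e i j < 1" "\<And>i j. f i j \<in> O(\<lambda>n. e i j ^ n)"
    using assms unfolding geometrically_small_def by metis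
  let ?E = "range (\<lambda>(i, j). e i j)"
  have "e i j \<le> Max ?E" for i j
    by (rule Max_ge) (auto intro: image_eqI[of _ _ "(i, j)"])
  moreover have "Max ?E < 1" using e(2) by (subst Max_less_iff) auto
  ultimately show ?thesis
    using e bigo_power_mono[OF e(3)] by (intro exI[of _ "Max ?E"]) (meson less_eq_real_def less_le_trans)
qed

theorem mainTheorem6:
  fixes \<xi> \<eta> :: "real ^ 'm::finite"
    and A :: "'l::finite \<Rightarrow> real ^ 'm ^ 'm"
    and B :: "real ^ 'm ^ 'm"
    and lam :: real
  assumes "nonneg_vec \<xi>" and "nonneg_vec \<eta>"
    and "\<And>i. nonneg_mat (A i)" and "nonneg_mat B"
    and "\<And>i. A i \<noteq> 0" and "B \<noteq> 0"
    and "\<forall>\<^sub>F n in sequentially. \<exists>w. length w = n \<and> \<xi> \<bullet> (word_mat A B w *v \<eta>) > 0"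
    and "primitive_mat (total_mat A B)"
    and "lam = pf_eigenvalue (total_mat A B)"
  shows "(\<exists>\<epsilon>::real. 0 < \<epsilon> \<and> \<epsilon> < 1 \<and>
            (\<forall>i j. (\<lambda>n. (cov_matrix (word_measure \<xi> A B \<eta> n) symbol_counts
                          - (real n *\<^sub>R gamma_mat A B + c_mat \<xi> A B \<eta>)) $ i $ j)
                   \<in> O(\<lambda>n. \<epsilon> ^ n)))
       \<and> (\<forall>i j. gamma_mat A B $ i $ j =
            1 / lam * partial_deriv i (partial_deriv j (y_fun A B)) 0
            - 1 / lam\<^sup>2 * partial_deriv i (y_fun A B) 0 * partial_deriv j (y_fun A B) 0)"
proof -
  interpret symbol_statistics A B using assms(3,4,8) by unfold_locales
  \<comment> \<open>One word of positive weight forces both vectors to be nonzero; as u and v are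
    strictly positive, \<xi>'P(0)\<eta> > 0, the constant by which all moments are divided.\<close>
  have "\<exists>w. \<xi> \<bullet> (word_mat A B w *v \<eta>) > 0"
    using eventually_happens[OF assms(7)] by auto
  then have "\<xi> \<noteq> 0" "\<eta> \<noteq> 0" by auto
  interpret perron "total_mat A B" "pf_left (total_mat A B)" "pf_right (total_mat A B)" "pf_eigenvalue (total_mat A B)"
    by (rule perron_pf[OF assms(8)])
  have "0 < \<xi> \<bullet> pf_right (total_mat A B)" "0 < \<eta> \<bullet> pf_left (total_mat A B)"
    using inner_pos_of_nonneg assms(1,2) \<open>\<xi> \<noteq> 0\<close> \<open>\<eta> \<noteq> 0\<close> u_pos v_pos by blast+
  then have "0 < bilin \<xi> \<eta> (pf_proj (tilted_mat A B 0))"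
    by (simp add: bilin_def pf_proj_def outer_mult_vec inner_commute)
  then have "geometrically_small (\<lambda>n. (cov_matrix (word_measure \<xi> A B \<eta> n) symbol_counts
      - (real n *\<^sub>R gamma_mat A B + c_mat \<xi> A B \<eta>)) $ i $ j)" for i j
    by (intro covariance_entry bilin_nonneg word_mat_nonneg assms)
  moreover have "y_fun A B 0 = lam" using assms(9) by (simp add: y_fun_def)
  ultimately show ?thesis
    using uniform_geometric_bound[of "\<lambda>i j n. (cov_matrix (word_measure \<xi> A B \<eta> n) symbol_counts
      - (real n *\<^sub>R gamma_mat A B + c_mat \<xi> A B \<eta>)) $ i $ j"] gamma_mat_eq
    by simp
qed

end
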